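(* Let $K$ be an algebraically closed field of characteristic zero, $R=K[X,Y]$, $\mathfrak{m}=(X,Y)$, and let $m,n$ be positive integers. Let $i,j,t,x$ be admissible parameters such that $\gcd(\frac{m}{i},\frac{n}{j})=t$. Suppose that $\nu$ is a rational rank $1$ non discrete valuation of $K(X,Y)$ dominating $R_{\mathfrak{m}}$ whose generating sequence $Q_0=X,\ Q_1=Y,\ Q_2,\dots$ consists of eigenfunctions for $H_{i,j,t,x}$. Let $\overline{\nu}=\nu|_{Q(A_{i,j,t,x})}$, where $Q(A_{i,j,t,x})$ denotes the quotient field of $A_{i,j,t,x}$. Then $\overline{\nu}$ does not split in $R_{\mathfrak{m}}$.
   Context: $\mathbb{N}=\{0,1,2,\dots\}$. Groups. Let $\alpha\in K$ be a primitive $m$-th root of unity, $\beta\in K$ a primitive $n$-th root of unity, $\mathbb{U}_m=\langle\alpha\rangle$, $\mathbb{U}_n=\langle\beta\rangle$. Positive integers $i,j,t,x$ are admissible if $i\mid m$, $j\mid n$, $t\mid \frac{m}{i}$, $t\mid\frac{n}{j}$, $\gcd(x,t)=1$ and $1\le x\le t$. For these, $H_{i,j,t,x}=\{(\alpha^{ai},\beta^{bj}) : a,b\in\mathbb{Z},\ b\equiv ax \pmod t\}$, a subgroup of $\mathbb{U}_m\times\mathbb{U}_n$ (every subgroup has this form). Action. $\mathbb{U}_m\times\mathbb{U}_n$ acts on $R$ by $K$-algebra automorphisms with $(\alpha^p,\beta^q)\cdot X=\alpha^pX$ and $(\alpha^p,\beta^q)\cdot Y=\beta^qY$. Put $A_{i,j,t,x}=R^{H_{i,j,t,x}}$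 (ring of invariants) and $\mathfrak{n}=\mathfrak{m}\cap A_{i,j,t,x}$. An element $f\in R$ is an eigenfunction for $H_{i,j,t,x}$ if for every $g\in H_{i,j,t,x}$ there is $\lambda_g\in K$ with $g\cdot f=\lambda_g f$. Valuations. $\nu$ is a valuation of $K(X,Y)$ with value group $\Phi_\nu$; it dominates a local ring if its valuation ring contains that ring and the maximal ideal of the valuation ring contracts to the maximal ideal of the ring. Rational rank $1$ means $\Phi_\nu\otimes\mathbb{Q}\cong\mathbb{Q}$ (so $\Phi_\nu$ is regarded as an ordered subgroup of $\mathbb{Q}$), and non discrete means $\Phi_\nu\not\cong\mathbb{Z}$. For a local domain $B\subset K(X,Y)$ dominated by $\nu$, $S^{B}(\nu)=\{\nu(f): 0\ne f\in B\}$. The generating sequence of $\nu$ is the sequence $(Q_l)_{l\ge0}$ in $R$ produced by the algorithm of Cutkosky and Vinh: $Q_0=X$, $Q_1=Y$, $\gamma_l=\nu(Q_l)$; for $l\ge1$, $\overline{m_l}=\min\{q\in\mathbb{Z}_{>0}: q\gamma_l\in \sum_{k=0}^{l-1}\gamma_k\mathbb{Z}\}$, and $Q_{l+1}=Q_l^{\overline{m_l}}-\lambda_l X^{c_0}Y^{c_1}Q_2^{c_2}\cdots Q_{l-1}^{c_{l-1}}$, where $\overline{m_l}\gamma_l=\sum_{k=0}^{l-1}c_k\gamma_k$ is the unique representation with $c_0\in\mathbb{N}$ and $0\le c_k<\overline{m_k}$ for $1\le k\le l-1$, and $\lambda_l\in K\setminus\{0\}$ is the unique element such that $\nu(Q_{l+1})>\overline{m_l}\gamma_l$.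 It has the following properties: (1) $\gamma_{l+1}>\overline{m_l}\gamma_l$ for $l\ge1$; (2) $Q_l$ ($l\ge1$) is monic in $Y$ of degree $d(l)=\deg_Y Q_l$, with $d(1)=1$ and $d(l)=\prod_{k=1}^{l-1}\overline{m_k}$ for $l\ge2$; (3) every $f\in R$ with $\deg_Y f=d$ has a unique expression $f=\sum_{e=0}^{d} f_e$, $f_e=(\sum_l b_{l,e}X^l)Q_1^{j_1(e)}\cdots Q_r^{j_r(e)}$ with $b_{l,e}\in K$, $0\le j_k(e)<\overline{m_k}$, $\deg_Y(Q_1^{j_1(e)}\cdots Q_r^{j_r(e)})=e$; the values of distinct nonzero $f_e$ are distinct, so $\nu(f)=\min_e\nu(f_e)$; (4) $S^{R_{\mathfrak{m}}}(\nu)=\sum_{l\ge0}\gamma_l\mathbb{N}$. Splitting. Suppose a local domain $B$ with quotient field $M$ dominates a local domain $A$ with quotient field $L$, and $\omega$ is a valuation of $L$ dominating $A$. We say that $\omega$ does not split in $B$ if there is a unique extension $\omega^*$ of $\omega$ to $M$ which dominates $B$ (valuations being considered up to equivalence). Here $A=(A_{i,j,t,x})_{\mathfrak{n}}$, $B=R_{\mathfrak{m}}$, $M=K(X,Y)$. *)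

theory Defs
  imports
    "HOL-Computational_Algebra.Polynomial"
    "HOL-Computational_Algebra.Fraction_Field"
    "HOL-Library.FuncSet"
    "HOL-Algebra.Free_Abelian_Groups"
begin

section \<open>Subrings of a field\<close>

definition quotient_field :: "'a::field set \<Rightarrow> 'a set" where
  "quotient_field A = {a / b | a b. a \<in> A \<and> b \<in> A \<and> b \<noteq> 0}"

definition nonunits :: "'a::field set \<Rightarrow> 'a set" where
  "nonunits A = {x \<in> A. \<not> (\<exists>y\<in>A. x * y = 1)}"

text \<open>A commutative ring is local iff its nonunits are closed under addition; then
  \<^term>\<open>nonunits A\<close> is the maximal ideal.\<close>
definition local_subring :: "'a::field set \<Rightarrow> bool" where
  "local_subring A \<longleftrightarrow> 1 \<in> A \<and> (\<forall>x\<in>A. \<forall>y\<in>A. x - y \<in> A \<and> x * y \<in> A) \<and>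
     (\<forall>x\<in>nonunits A. \<forall>y\<in>nonunits A. x + y \<in> nonunits A)"

definition ring_dominates :: "'a::field set \<Rightarrow> 'a set \<Rightarrow> bool" where
  "ring_dominates B A \<longleftrightarrow> A \<subseteq> B \<and> nonunits B \<inter> A = nonunits A"

section \<open>Valuations\<close>

text \<open>Valuations on a subfield \<open>L\<close> of an ambient field, written additively. The conventional
  value \<open>\<infinity>\<close> at 0 is not represented: no notion below inspects \<open>v 0\<close>.\<close>
definition valuation_on :: "'a::field set \<Rightarrow> ('a \<Rightarrow> 'g::linordered_ab_group_add) \<Rightarrow> bool" where
  "valuation_on L v \<longleftrightarrow>
     (\<forall>x\<in>L - {0}. \<forall>y\<in>L - {0}. v (x * y) = v x + v y) \<and>
     (\<forall>x\<in>L - {0}. \<forall>y\<in>L - {0}. x + y \<noteq> 0 \<longrightarrow> v (x + y) \<ge> min (v x) (v y))"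

definition valuation_ring :: "'a::field set \<Rightarrow> ('a \<Rightarrow> 'g::linordered_ab_group_add) \<Rightarrow> 'a set" where
  "valuation_ring L v = {x \<in> L. x = 0 \<or> v x \<ge> 0}"

definition valuation_ideal :: "'a::field set \<Rightarrow> ('a \<Rightarrow> 'g::linordered_ab_group_add) \<Rightarrow> 'a set" where
  "valuation_ideal L v = {x \<in> L. x = 0 \<or> v x > 0}"

definition valuation_dominates ::
  "'a::field set \<Rightarrow> ('a \<Rightarrow> 'g::linordered_ab_group_add) \<Rightarrow> 'a set \<Rightarrow> bool" where
  "valuation_dominates L v A \<longleftrightarrow>
     A \<subseteq> valuation_ring L v \<and> valuation_ideal L v \<inter> A = nonunits A"

definition value_group :: "'a::field set \<Rightarrow> ('a \<Rightarrow> 'g::linordered_ab_group_add) \<Rightarrow> 'g monoid" where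
  "value_group L v = \<lparr>carrier = v ` (L - {0}), monoid.mult = (+), one = 0\<rparr>"

text \<open>Equivalence of valuations: an order-preserving isomorphism of the value groups carries
  one to the other. The two value groups may live in different types.\<close>
definition valuation_equiv ::
  "'a::field set \<Rightarrow> ('a \<Rightarrow> 'g::linordered_ab_group_add) \<Rightarrow> ('a \<Rightarrow> 'h::linordered_ab_group_add) \<Rightarrow> bool" where
  "valuation_equiv L v w \<longleftrightarrow>
     (\<exists>\<phi> \<in> iso (value_group L v) (value_group L w).
        strict_mono_on (v ` (L - {0})) \<phi> \<and> (\<forall>x\<in>L - {0}. w x = \<phi> (v x)))"

section \<open>Rational rank one, discreteness\<close>

text \<open>The tensor product over the integers: the free Abelian group on pairs, modulo
  biadditivity.\<close>
definition tensor_relations :: "'a monoid \<Rightarrow> 'b monoid \<Rightarrow> (('a \<times> 'b) \<Rightarrow>\<^sub>0 int) set" where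
  "tensor_relations G H =
     {frag_of (x \<otimes>\<^bsub>G\<^esub> y, z) - frag_of (x, z) - frag_of (y, z) | x y z.
        x \<in> carrier G \<and> y \<in> carrier G \<and> z \<in> carrier H} \<union>
     {frag_of (x, y \<otimes>\<^bsub>H\<^esub> z) - frag_of (x, y) - frag_of (x, z) | x y z.
        x \<in> carrier G \<and> y \<in> carrier H \<and> z \<in> carrier H}"

definition tensor_group :: "'a monoid \<Rightarrow> 'b monoid \<Rightarrow> (('a \<times> 'b) \<Rightarrow>\<^sub>0 int) set monoid" where
  "tensor_group G H =
     free_Abelian_group (carrier G \<times> carrier H) Mod
       generate (free_Abelian_group (carrier G \<times> carrier H)) (tensor_relations G H)"

definition rational_group :: "rat monoid" where
  "rational_group = \<lparr>carrier = UNIV, monoid.mult = (+), one = 0\<rparr>"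

definition rational_rank_one :: "'a::field set \<Rightarrow> ('a \<Rightarrow> 'g::linordered_ab_group_add) \<Rightarrow> bool" where
  "rational_rank_one L v \<longleftrightarrow> tensor_group (value_group L v) rational_group \<cong> rational_group"

definition discrete_valuation :: "'a::field set \<Rightarrow> ('a \<Rightarrow> 'g::linordered_ab_group_add) \<Rightarrow> bool" where
  "discrete_valuation L v \<longleftrightarrow> value_group L v \<cong> integer_group"

section \<open>Splitting\<close>

text \<open>\<open>\<omega>\<close> does not split in \<open>B\<close>: up to equivalence there is exactly one extension of \<open>\<omega>\<close> to the
  quotient field of \<open>B\<close> that dominates \<open>B\<close>. The first three lines are the setting in which
  the notion is used. HOL cannot quantify over value group types inside a formula, so
  uniqueness is tested against the valuations with values in the type \<open>'h\<close>; a theorem with \<open>'h\<close>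
  a free type variable covers all value groups. The extension asserted to exist takes values
  in the type of the values of \<open>\<omega>\<close>.\<close>
definition does_not_split ::
  "'h::linordered_ab_group_add itself \<Rightarrow> 'a::field set \<Rightarrow> 'a set \<Rightarrow>
     ('a \<Rightarrow> 'g::linordered_ab_group_add) \<Rightarrow> bool" where
  "does_not_split _ A B \<omega> \<longleftrightarrow>
     local_subring A \<and> local_subring B \<and> ring_dominates B A \<and>
     valuation_on (quotient_field A) \<omega> \<and>
     valuation_dominates (quotient_field A) \<omega> A \<and>
     (\<exists>\<omega>' :: 'a \<Rightarrow> 'g.
        valuation_on (quotient_field B) \<omega>' \<and>
        valuation_equiv (quotient_field A) \<omega> \<omega>' \<and>
        valuation_dominates (quotient_field B) \<omega>' B \<and>
        (\<forall>\<omega>'' :: 'a \<Rightarrow> 'h.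
           valuation_on (quotient_field B) \<omega>'' \<and>
           valuation_equiv (quotient_field A) \<omega> \<omega>'' \<and>
           valuation_dominates (quotient_field B) \<omega>'' B \<longrightarrow>
           valuation_equiv (quotient_field B) \<omega>' \<omega>''))"

section \<open>The polynomial ring in two variables\<close>

text \<open>\<open>K[X,Y]\<close> is \<open>K[X][Y]\<close>, i.e. \<open>'k poly poly\<close> with \<open>X\<close> the inner and \<open>Y\<close> the outer
  variable; \<open>K(X,Y)\<close> is \<open>'k poly poly fract\<close>.\<close>
definition varX :: "'k::field poly poly" where
  "varX = [:[:0, 1:]:]"

definition varY :: "'k::field poly poly" where
  "varY = [:0, 1:]"

definition const2 :: "'k::field \<Rightarrow> 'k poly poly" where
  "const2 c = [:[:c:]:]"

definition maxideal_XY :: "'k::field poly poly set" where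
  "maxideal_XY = {f * varX + g * varY | f g. True}"

definition emb :: "'a::idom \<Rightarrow> 'a fract" where
  "emb f = Fraction_Field.Fract f 1"

definition localization :: "'a::idom set \<Rightarrow> 'a set \<Rightarrow> 'a fract set" where
  "localization A P = {emb f / emb g | f g. f \<in> A \<and> g \<in> A - P}"

section \<open>The group action\<close>

definition primitive_root :: "nat \<Rightarrow> 'k::field \<Rightarrow> bool" where
  "primitive_root m \<alpha> \<longleftrightarrow> m > 0 \<and> \<alpha> ^ m = 1 \<and> (\<forall>k. 0 < k \<and> k < m \<longrightarrow> \<alpha> ^ k \<noteq> 1)"

definition admissible :: "nat \<Rightarrow> nat \<Rightarrow> nat \<Rightarrow> nat \<Rightarrow> nat \<Rightarrow> nat \<Rightarrow> bool" where
  "admissible m n i j t x \<longleftrightarrow>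
     i > 0 \<and> j > 0 \<and> t > 0 \<and> x > 0 \<and>
     i dvd m \<and> j dvd n \<and> t dvd m div i \<and> t dvd n div j \<and> gcd x t = 1 \<and> 1 \<le> x \<and> x \<le> t"

definition subgroup_H :: "'k::field \<Rightarrow> 'k \<Rightarrow> nat \<Rightarrow> nat \<Rightarrow> nat \<Rightarrow> nat \<Rightarrow> ('k \<times> 'k) set" where
  "subgroup_H \<alpha> \<beta> i j t x =
     {(\<alpha> powi (a * int i), \<beta> powi (b * int j)) | a b :: int. b mod int t = (a * int x) mod int t}"

text \<open>The substitution \<open>X \<mapsto> fst g * X\<close>, \<open>Y \<mapsto> snd g * Y\<close>.\<close>
definition act :: "'k::field \<times> 'k \<Rightarrow> 'k poly poly \<Rightarrow> 'k poly poly" where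
  "act g f = pcompose (map_poly (\<lambda>c. pcompose c [:0, fst g:]) f) [:0, [:snd g:]:]"

definition invariants :: "('k::field \<times> 'k) set \<Rightarrow> 'k poly poly set" where
  "invariants H = {f. \<forall>g\<in>H. act g f = f}"

definition eigenfunction :: "('k::field \<times> 'k) set \<Rightarrow> 'k poly poly \<Rightarrow> bool" where
  "eigenfunction H f \<longleftrightarrow> (\<forall>g\<in>H. \<exists>c. act g f = const2 c * f)"

section \<open>Generating sequences\<close>

definition nat_mult :: "nat \<Rightarrow> 'g::ab_group_add \<Rightarrow> 'g" where
  "nat_mult q \<gamma> = (\<Sum>_<q. \<gamma>)"

definition int_mult :: "int \<Rightarrow> 'g::ab_group_add \<Rightarrow> 'g" where
  "int_mult a \<gamma> = (if a \<ge> 0 then nat_mult (nat a) \<gamma> else - nat_mult (nat (- a)) \<gamma>)"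

definition mbar :: "(nat \<Rightarrow> 'g::ab_group_add) \<Rightarrow> nat \<Rightarrow> nat" where
  "mbar \<gamma> l = (LEAST q. q > 0 \<and> (\<exists>a :: nat \<Rightarrow> int. nat_mult q (\<gamma> l) = (\<Sum>k<l. int_mult (a k) (\<gamma> k))))"

text \<open>The exponents \<open>c\<close> and the scalar \<open>lam\<close> are determined uniquely by \<open>v\<close> and the preceding \<open>Q k\<close>.\<close>
definition generating_sequence ::
  "('k::field poly poly fract \<Rightarrow> 'g::linordered_ab_group_add) \<Rightarrow> (nat \<Rightarrow> 'k poly poly) \<Rightarrow> bool" where
  "generating_sequence v Q \<longleftrightarrow>
     (let \<gamma> = (\<lambda>l. v (emb (Q l))) in
      Q 0 = varX \<and> Q 1 = varY \<and>
      (\<forall>l\<ge>1. \<exists>(c :: nat \<Rightarrow> nat) lam.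
         (\<forall>k. 1 \<le> k \<and> k < l \<longrightarrow> c k < mbar \<gamma> k) \<and>
         nat_mult (mbar \<gamma> l) (\<gamma> l) = (\<Sum>k<l. nat_mult (c k) (\<gamma> k)) \<and>
         lam \<noteq> 0 \<and>
         Q (Suc l) = Q l ^ mbar \<gamma> l - const2 lam * (\<Prod>k<l. Q k ^ c k) \<and>
         \<gamma> (Suc l) > nat_mult (mbar \<gamma> l) (\<gamma> l)))"

end

theory Submission
  imports Defs
begin

text \<open>Uniqueness of the extension rests on the invariance of \<open>\<nu>\<close> under the group. Rational
  rank one embeds the value group into the rationals, and then the values \<open>\<gamma> l\<close> of the
  generating sequence are unbounded. Dividing successively by the \<open>Q l\<close>
  writes a polynomial as a sum of products of \<open>Q l\<close> with distinct values, up to a term of value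
  larger than any given bound. The group acts on such products by nonzero scalars, hence
  preserves values. Now if \<open>z\<close> in \<open>K(X,Y)\<close> has nonnegative value, so do its conjugates, and the
  polynomial with these conjugates as roots makes \<open>z\<close> integral over the valuation ring of
  \<open>\<nu>\<close> restricted to the invariant field. So every extension of this restriction is nonnegative at
  \<open>z\<close>; with the norm of \<open>z\<close>, positivity is preserved as well, and the extension is equivalent to \<open>\<nu>\<close>.\<close>

section \<open>Ring homomorphisms and polynomials\<close>

text \<open>Since the finite group H permutes the extensions of a valuation of its fixed field
  transitively, uniqueness amounts to invariance of \<nu>. The difficulty is cancellation: a
  polynomial and its translate are sums of terms, and knowing the values of the terms is not enough.
  The minimality that defines \<open>mbar\<close> settles this: in an expansion in powers of
  \<open>Q l\<close> with fewer than \<open>mb l + 1\<close> terms, the values lie in distinct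
  cosets of the group generated by the earlier values, so the least one survives in both sums. This
  reaches only polynomials whose degree in Y is below that of \<open>Q l\<close>. The degrees may
  stay bounded, namely when \<open>mb l = 1\<close> from some point on, so a given polynomial need
  not be covered by any l; this is why a single division by a \<open>Q l\<close> of large value
  comes on top. The value groups are abstract, and those of two extensions may live in different
  types. Hence extensions are compared through the signs of their values, and rational rank one,
  given as a statement on a tensor product, is first turned into an order embedding into
  \<open>rat\<close>.\<close>

locale ring_map =
  fixes h :: "'a::comm_ring_1 \<Rightarrow> 'b::comm_ring_1"
  assumes map_1 [simp]: "h 1 = 1"
    and map_add: "h (x + y) = h x + h y"
    and map_mult: "h (x * y) = h x * h y"
begin

lemma map_0 [simp]: "h 0 = 0"
  using map_add[of 0 0] by simp

lemma map_uminus: "h (- x) = - h x"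
  using map_add[of x "- x"] by (simp add: eq_neg_iff_add_eq_0 add.commute)

lemma map_diff: "h (x - y) = h x - h y"
  using map_add[of x "- y"] by (simp add: map_uminus)

lemma map_sum: "h (sum f S) = (\<Sum>x\<in>S. h (f x))"
  by (induction S rule: infinite_finite_induct) (simp_all add: map_add)

lemma map_prod: "h (prod f S) = (\<Prod>x\<in>S. h (f x))"
  by (induction S rule: infinite_finite_induct) (simp_all add: map_mult)

lemma map_power: "h (x ^ n) = h x ^ n"
  by (induction n) (simp_all add: map_mult)

lemma ring_map_map_poly: "ring_map (map_poly h)"
proof
  show "map_poly h (p + q) = map_poly h p + map_poly h q" for p q
    by (rule poly_eqI) (simp add: coeff_map_poly map_add)
  show "map_poly h (p * q) = map_poly h p * map_poly h q" for p q
    by (rule poly_eqI) (simp add: coeff_map_poly coeff_mult map_sum map_mult)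
qed simp

end

lemma ring_map_comp: "ring_map h \<Longrightarrow> ring_map k \<Longrightarrow> ring_map (k \<circ> h)"
  by (simp add: ring_map_def)

lemma ring_map_pcompose: "ring_map (\<lambda>p. pcompose p q)"
  by (simp add: ring_map_def pcompose_1 pcompose_add pcompose_mult)

lemma coeff_pcompose_monomial:
  fixes p :: "'a::comm_semiring_1 poly"
  shows "coeff (pcompose p [:0, c:]) n = c ^ n * coeff p n"
proof (induction p arbitrary: n)
  case (pCons a p)
  then show ?case
    by (cases n) (simp_all add: pcompose_pCons mult_ac)
qed simp

text \<open>The coefficients will lie in K[X], which is not a field. Pseudo-division scales the
  dividend by a power of the leading coefficient of g, and that power is 1 here.\<close>

lemma monic_division:
  fixes f g :: "'a::comm_ring_1 poly"
  assumes "lead_coeff g = 1"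
  obtains q r where "f = g * q + r" "r = 0 \<or> degree r < degree g"
proof -
  from assms have g: "g \<noteq> 0" by auto
  obtain q r where qr: "pseudo_divmod f g = (q, r)" by fastforce
  show thesis
    using that pseudo_divmod[OF g qr] assms by simp
qed

section \<open>The polynomial ring in two variables\<close>

lemma emb_0 [simp]: "emb 0 = 0"
  and emb_1 [simp]: "emb 1 = 1"
  and emb_add: "emb (f + g) = emb f + emb g"
  and emb_mult: "emb (f * g) = emb f * emb g"
  by (simp_all add: emb_def Zero_fract_def One_fract_def)

interpretation emb: ring_map emb
  by unfold_locales (simp_all add: emb_add emb_mult)

lemma emb_eq_iff [simp]: "emb f = emb g \<longleftrightarrow> f = g"
  by (simp add: emb_def eq_fract)

lemma emb_eq_0_iff [simp]: "emb f = 0 \<longleftrightarrow> f = 0"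
  using emb_eq_iff[of f 0] by (simp del: emb_eq_iff)

lemma fract_eq_quotient:
  obtains f g where "z = emb f / emb g" "g \<noteq> 0"
  by (cases z) (auto simp: emb_def)

lemma ring_map_act: "ring_map (act g)"
proof -
  have "act g = (\<lambda>f. pcompose f [:0, [:snd g:]:]) \<circ> map_poly (\<lambda>c. pcompose c [:0, fst g:])"
    by (simp add: act_def fun_eq_iff)
  then show ?thesis
    by (simp add: ring_map_comp ring_map_pcompose ring_map.ring_map_map_poly)
qed

interpretation act: ring_map "act g" for g
  by (rule ring_map_act)

text \<open>The action is diagonal in the monomial basis; its composition law and its injectivity
  are read off from this formula.\<close>

lemma coeff_act: "coeff (coeff (act g f) k) l = fst g ^ l * snd g ^ k * coeff (coeff f k) l"
proof -
  have *: "[:c::'a:] ^ k = [:c ^ k:]" for c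
    by (induction k) (simp_all add: one_pCons)
  show ?thesis
    by (simp add: act_def coeff_pcompose_monomial coeff_map_poly * mult_ac)
qed

lemma poly2_eqI:
  assumes "\<And>k l. coeff (coeff f k) l = coeff (coeff g k) l"
  shows "f = g"
  using assms by (intro poly_eqI)

lemma act_act: "act g (act h f) = act (fst g * fst h, snd g * snd h) f"
  by (rule poly2_eqI) (simp add: coeff_act power_mult_distrib mult_ac)

lemma act_one [simp]: "act (1, 1) f = f"
  by (rule poly2_eqI) (simp add: coeff_act)

lemma act_eq_0_iff:
  assumes "fst g \<noteq> 0" "snd g \<noteq> 0"
  shows "act g f = 0 \<longleftrightarrow> f = 0"
  using assms by (auto simp: poly_eq_iff coeff_act)

text \<open>The residue map of R at the origin. Its kernel is \<open>maxideal_XY\<close>, so the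
  condition on denominators becomes nonvanishing under a ring homomorphism.\<close>

definition origin_eval :: "'k::field poly poly \<Rightarrow> 'k" where
  "origin_eval f = poly (poly f 0) 0"

interpretation origin_eval: ring_map origin_eval
  by unfold_locales (simp_all add: origin_eval_def)

lemma origin_eval_const2 [simp]: "origin_eval (const2 c) = c"
  by (simp add: origin_eval_def const2_def)

lemma maxideal_XY_iff: "f \<in> maxideal_XY \<longleftrightarrow> origin_eval f = 0"
proof
  assume "f \<in> maxideal_XY"
  then show "origin_eval f = 0"
    by (auto simp: maxideal_XY_def origin_eval_def varX_def varY_def)
next
  assume f: "origin_eval f = 0"
  obtain p f' where 1: "f = pCons p f'" by (cases f)
  obtain c p' where 2: "p = pCons c p'" by (cases p)
  from f have "c = 0"
    by (simp add: origin_eval_def 1 2)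
  then have "f = [:p':] * varX + f' * varY"
    by (simp add: 1 2 varX_def varY_def)
  then show "f \<in> maxideal_XY"
    unfolding maxideal_XY_def by blast
qed

section \<open>Localizations at the origin\<close>

text \<open>The instances are the full polynomial ring and the ring of invariants, so both local
  rings of the theorem are treated at once.\<close>

locale poly_subring =
  fixes A :: "'k::field poly poly set"
  assumes one_mem: "1 \<in> A"
    and diff_mem: "f \<in> A \<Longrightarrow> g \<in> A \<Longrightarrow> f - g \<in> A"
    and mult_mem: "f \<in> A \<Longrightarrow> g \<in> A \<Longrightarrow> f * g \<in> A"
begin

definition "loc = localization A (maxideal_XY \<inter> A)"

lemma zero_mem: "0 \<in> A"
  using diff_mem[OF one_mem one_mem] by simp

lemma add_mem: "f \<in> A \<Longrightarrow> g \<in> A \<Longrightarrow> f + g \<in> A"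
  using diff_mem[of f "0 - g"] diff_mem[of 0 g] zero_mem by simp

lemma loc_alt: "loc = {emb f / emb g | f g. f \<in> A \<and> g \<in> A \<and> origin_eval g \<noteq> 0}"
  unfolding loc_def localization_def by (auto simp: maxideal_XY_iff)

lemma locE:
  assumes "z \<in> loc"
  obtains f g where "z = emb f / emb g" "f \<in> A" "g \<in> A" "origin_eval g \<noteq> 0" "g \<noteq> 0"
proof -
  from assms obtain f g where "z = emb f / emb g" "f \<in> A" "g \<in> A" "origin_eval g \<noteq> 0"
    unfolding loc_alt by blast
  moreover from this have "g \<noteq> 0" by auto
  ultimately show thesis using that by blast
qed

lemma locI: "f \<in> A \<Longrightarrow> g \<in> A \<Longrightarrow> origin_eval g \<noteq> 0 \<Longrightarrow> emb f / emb g \<in> loc"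
  unfolding loc_alt by blast

lemma emb_mem_loc: "f \<in> A \<Longrightarrow> emb f \<in> loc"
  using locI[of f 1] one_mem by simp

text \<open>The criterion on the right does not mention A. This is what makes the localization of R
  dominate that of every subring.\<close>

lemma nonunits_loc_iff:
  assumes "f \<in> A" "g \<in> A" "origin_eval g \<noteq> 0"
  shows "emb f / emb g \<in> nonunits loc \<longleftrightarrow> origin_eval f = 0"
proof
  have g: "g \<noteq> 0" using assms by auto
  show "origin_eval f = 0" if "emb f / emb g \<in> nonunits loc"
  proof (rule ccontr)
    assume f: "origin_eval f \<noteq> 0"
    then have "f \<noteq> 0" by auto
    with g have "emb f / emb g * (emb g / emb f) = 1" by simp
    with locI[OF assms(2) assms(1) f] that show False
      unfolding nonunits_def by blast
  qed
  show "emb f / emb g \<in> nonunits loc" if f: "origin_eval f = 0"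
    unfolding nonunits_def
  proof (intro CollectI conjI notI)
    show "emb f / emb g \<in> loc" by (intro locI assms)
    assume "\<exists>y\<in>loc. emb f / emb g * y = 1"
    then obtain f' g' where "emb f / emb g * (emb f' / emb g') = 1" "origin_eval g' \<noteq> 0" "g' \<noteq> 0"
      by (metis locE)
    with g have "emb (f * f') = emb (g * g')"
      by (simp add: emb_mult field_simps)
    then have "origin_eval (f * f') = origin_eval (g * g')"
      by (simp del: emb.map_mult)
    with f assms(3) \<open>origin_eval g' \<noteq> 0\<close> show False
      by (simp add: origin_eval.map_mult)
  qed
qed

lemma local_subring_loc: "local_subring loc"
  unfolding local_subring_def
proof (intro conjI ballI)
  show "1 \<in> loc" using emb_mem_loc[OF one_mem] by simp
next
  fix x y assume "x \<in> loc" "y \<in> loc"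
  then obtain f g f' g' where
    x: "x = emb f / emb g" "f \<in> A" "g \<in> A" "origin_eval g \<noteq> 0" "g \<noteq> 0" and
    y: "y = emb f' / emb g'" "f' \<in> A" "g' \<in> A" "origin_eval g' \<noteq> 0" "g' \<noteq> 0"
    by (metis locE)
  have "x - y = emb (f * g' - f' * g) / emb (g * g')"
    using x y by (simp add: emb_mult emb.map_diff diff_frac_eq)
  then show "x - y \<in> loc"
    using x y by (auto intro!: locI mult_mem diff_mem simp: origin_eval.map_mult)
  have "x * y = emb (f * f') / emb (g * g')"
    using x y by (simp add: emb_mult)
  then show "x * y \<in> loc"
    using x y by (auto intro!: locI mult_mem diff_mem simp: origin_eval.map_mult)
next
  fix x y assume xy: "x \<in> nonunits loc" "y \<in> nonunits loc"
  then have "x \<in> loc" "y \<in> loc" by (auto simp: nonunits_def)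
  then obtain f g f' g' where
    x: "x = emb f / emb g" "f \<in> A" "g \<in> A" "origin_eval g \<noteq> 0" "g \<noteq> 0" and
    y: "y = emb f' / emb g'" "f' \<in> A" "g' \<in> A" "origin_eval g' \<noteq> 0" "g' \<noteq> 0"
    by (metis locE)
  have f: "origin_eval f = 0" "origin_eval f' = 0"
    using xy x y nonunits_loc_iff by auto
  have "x + y = emb (f * g' + f' * g) / emb (g * g')"
    using x y by (simp add: emb_mult emb.map_add add_frac_eq)
  moreover have "emb (f * g' + f' * g) / emb (g * g') \<in> nonunits loc"
    using x y f by (subst nonunits_loc_iff)
      (auto intro!: mult_mem add_mem simp: origin_eval.map_mult origin_eval.map_add)
  ultimately show "x + y \<in> nonunits loc" by simp
qed

lemma quotient_field_loc: "quotient_field loc = quotient_field (emb ` A)"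
proof
  show "quotient_field loc \<subseteq> quotient_field (emb ` A)"
  proof
    fix z assume "z \<in> quotient_field loc"
    then obtain x y where z: "z = x / y" "x \<in> loc" "y \<in> loc" "y \<noteq> 0"
      unfolding quotient_field_def by blast
    then obtain f g f' g' where
      x: "x = emb f / emb g" "f \<in> A" "g \<in> A" "g \<noteq> 0" and
      y: "y = emb f' / emb g'" "f' \<in> A" "g' \<in> A" "g' \<noteq> 0"
      by (metis locE)
    have "z = emb (f * g') / emb (g * f')"
      using x y z by (simp add: emb_mult)
    moreover have "emb (g * f') \<noteq> 0" using x y z by auto
    moreover have "f * g' \<in> A" "g * f' \<in> A" using x y mult_mem by auto
    ultimately show "z \<in> quotient_field (emb ` A)"
      unfolding quotient_field_def by blast
  qed
  show "quotient_field (emb ` A) \<subseteq> quotient_field loc"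
    unfolding quotient_field_def using emb_mem_loc by blast
qed

end

interpretation UNIV: poly_subring UNIV
  by unfold_locales auto

lemma UNIV_loc: "UNIV.loc = localization UNIV maxideal_XY"
  by (simp add: UNIV.loc_def)

lemma quotient_field_UNIV_loc: "quotient_field UNIV.loc = UNIV"
proof -
  have "z \<in> quotient_field (range emb)" for z :: "'a poly poly fract"
  proof -
    obtain f g where "z = emb f / emb g" "emb g \<noteq> 0"
      by (metis fract_eq_quotient emb_eq_0_iff)
    then show ?thesis unfolding quotient_field_def by blast
  qed
  then show ?thesis
    by (auto simp: UNIV.quotient_field_loc)
qed

lemma (in poly_subring) ring_dominates_loc: "ring_dominates UNIV.loc loc"
  unfolding ring_dominates_def
proof
  show "loc \<subseteq> UNIV.loc"
    by (auto elim!: locE intro!: UNIV.locI)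
  moreover have "z \<in> nonunits UNIV.loc \<longleftrightarrow> z \<in> nonunits loc" if "z \<in> loc" for z
    using that nonunits_loc_iff UNIV.nonunits_loc_iff by (metis locE UNIV_I)
  ultimately show "nonunits UNIV.loc \<inter> loc = nonunits loc"
    by (auto simp: nonunits_def[of loc])
qed

section \<open>Multiples in ordered groups\<close>

lemma nat_mult_0 [simp]: "nat_mult 0 x = 0"
  and nat_mult_Suc [simp]: "nat_mult (Suc q) x = nat_mult q x + x"
  by (simp_all add: nat_mult_def)

lemma nat_mult_add_left: "nat_mult (p + q) x = nat_mult p x + nat_mult q x"
  by (induction q) (simp_all add: add.assoc)

lemma nat_mult_add_right: "nat_mult q (x + y) = nat_mult q x + nat_mult q y"
  by (simp add: nat_mult_def sum.distrib)

lemma nat_mult_uminus: "nat_mult q (- x) = - nat_mult q x"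
  by (simp add: nat_mult_def sum_negf)

lemma nat_mult_pos:
  fixes x :: "'g::linordered_ab_group_add"
  assumes "x > 0" "q > 0"
  shows "nat_mult q x > 0"
  using assms by (auto simp: nat_mult_def intro!: sum_pos)

lemma nat_mult_nonneg:
  fixes x :: "'g::linordered_ab_group_add"
  shows "x \<ge> 0 \<Longrightarrow> nat_mult q x \<ge> 0"
  by (simp add: nat_mult_def sum_nonneg)

lemma nat_mult_mono:
  fixes x :: "'g::linordered_ab_group_add"
  shows "x \<le> y \<Longrightarrow> nat_mult q x \<le> nat_mult q y"
  by (simp add: nat_mult_def sum_mono)

text \<open>A linearly ordered group is torsion-free: multiples of a positive element stay positive,
  and negation covers the other sign.\<close>

lemma nat_mult_eq_0_iff:
  fixes x :: "'g::linordered_ab_group_add"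
  assumes "q > 0"
  shows "nat_mult q x = 0 \<longleftrightarrow> x = 0"
proof
  assume q: "nat_mult q x = 0"
  consider "x = 0" | "x > 0" | "- x > 0" by fastforce
  then show "x = 0"
    using q assms nat_mult_pos[of x q] nat_mult_pos[of "- x" q]
    by cases (auto simp: nat_mult_uminus)
qed (simp add: nat_mult_def)

text \<open>Writing integers as differences of naturals removes the case distinction in
  \<open>int_mult\<close>, so that additivity in the integer needs no analysis of signs.\<close>

lemma int_mult_diff_of_nat: "int_mult (int p - int q) x = nat_mult p x - nat_mult q x"
proof (cases "p \<ge> q")
  case True
  then obtain d where "p = q + d" using le_Suc_ex by blast
  then show ?thesis by (simp add: int_mult_def nat_mult_add_left)
next
  case False
  then obtain d where "q = p + d" by (metis le_Suc_ex nat_le_linear)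
  then show ?thesis
    by (cases "d = 0") (simp_all add: int_mult_def nat_mult_add_left)
qed

lemma int_mult_of_nat: "int_mult (int p) x = nat_mult p x"
  using int_mult_diff_of_nat[of p 0 x] by simp

lemma int_mult_0 [simp]: "int_mult 0 x = 0"
  using int_mult_of_nat[of 0 x] by simp

lemma int_mult_1 [simp]: "int_mult 1 x = x"
  using int_mult_of_nat[of 1 x] by simp

lemma int_mult_add_left: "int_mult (a + b) x = int_mult a x + int_mult b x"
proof -
  obtain p q r s where "a = int p - int q" "b = int r - int s"
    by (metis int_diff_cases)
  moreover have "int p - int q + (int r - int s) = int (p + r) - int (q + s)" by simp
  ultimately show ?thesis
    by (simp only: int_mult_diff_of_nat) (simp add: nat_mult_add_left)
qed

lemma int_mult_minus_left: "int_mult (- a) x = - int_mult a x"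
  using int_mult_add_left[of a "- a" x] by (simp add: eq_neg_iff_add_eq_0 add.commute)

lemma int_mult_diff_left: "int_mult (a - b) x = int_mult a x - int_mult b x"
  using int_mult_add_left[of a "- b" x] by (simp add: int_mult_minus_left)

lemma int_mult_add_right: "int_mult a (x + y) = int_mult a x + int_mult a y"
  by (simp add: int_mult_def nat_mult_add_right)

section \<open>Groups of rational rank one\<close>

text \<open>Claiming integrality for all multiples of d allows several denominators to be cleared by
  the product of their bounds.\<close>

lemma rat_common_denominator:
  obtains d :: nat where "d > 0" "\<And>D. d dvd D \<Longrightarrow> of_nat D * (r :: rat) \<in> \<int>"
proof -
  obtain a b where r: "quotient_of r = (a, b)" by fastforce
  have b: "b > 0" using quotient_of_denom_pos[OF r] .
  have "of_nat D * r \<in> \<int>" if D: "nat b dvd D" for D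
  proof -
    from D obtain c where "D = nat b * c" by blast
    then have "of_nat D = (of_int b * of_nat c :: rat)"
      using b by simp
    then have "of_nat D * r = of_int (a * int c)"
      using b quotient_of_div[OF r] by simp
    then show ?thesis by (metis Ints_of_int)
  qed
  with b that[of "nat b"] show thesis by simp
qed

text \<open>The biadditive map sending the pair of \<open>x\<close> and \<open>r\<close> to \<open>D r x\<close>, extended to formal sums;
  the floor only makes it total and is exact once \<open>D\<close> clears all denominators.\<close>
definition scaled_sum :: "nat \<Rightarrow> (('g::ab_group_add \<times> rat) \<Rightarrow>\<^sub>0 int) \<Rightarrow> 'g" where
  "scaled_sum D z =
     (\<Sum>p\<in>Poly_Mapping.keys z. int_mult (Poly_Mapping.lookup z p * \<lfloor>of_nat D * snd p\<rfloor>) (fst p))"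

lemma scaled_sum_superset:
  assumes "finite K" "Poly_Mapping.keys z \<subseteq> K"
  shows "scaled_sum D z =
    (\<Sum>p\<in>K. int_mult (Poly_Mapping.lookup z p * \<lfloor>of_nat D * snd p\<rfloor>) (fst p))"
  unfolding scaled_sum_def
  by (rule sum.mono_neutral_left) (use assms in \<open>auto simp: in_keys_iff\<close>)

lemma scaled_sum_add: "scaled_sum D (z + w) = scaled_sum D z + scaled_sum D w"
proof -
  let ?K = "Poly_Mapping.keys z \<union> Poly_Mapping.keys w"
  have "Poly_Mapping.keys (z + w) \<subseteq> ?K" by (rule keys_add)
  then show ?thesis
    by (simp add: scaled_sum_superset[of ?K] lookup_add distrib_right int_mult_add_left sum.distrib)
qed

lemma scaled_sum_minus: "scaled_sum D (- z) = - scaled_sum D z"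
  by (simp add: scaled_sum_def int_mult_minus_left sum_negf keys_minus)

lemma scaled_sum_diff: "scaled_sum D (z - w) = scaled_sum D z - scaled_sum D w"
  using scaled_sum_add[of D z "- w"] by (simp add: scaled_sum_minus)

lemma scaled_sum_frag_of: "scaled_sum D (frag_of (x, r)) = int_mult \<lfloor>of_nat D * r\<rfloor> x"
  by (simp add: scaled_sum_def)

lemma tensor_relations_subset:
  fixes S :: "'g::ab_group_add set"
  assumes "\<And>x y. x \<in> S \<Longrightarrow> y \<in> S \<Longrightarrow> x + y \<in> S"
  shows "tensor_relations \<lparr>carrier = S, monoid.mult = (+), one = 0\<rparr> rational_group
    \<subseteq> carrier (free_Abelian_group (S \<times> UNIV))"
proof
  fix r assume "r \<in> tensor_relations \<lparr>carrier = S, monoid.mult = (+), one = 0\<rparr> rational_group"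
  then obtain a b c :: "'g \<times> rat" where
    r: "r = frag_of a - frag_of b - frag_of c" "a \<in> S \<times> UNIV" "b \<in> S \<times> UNIV" "c \<in> S \<times> UNIV"
    by (auto simp: tensor_relations_def rational_group_def assms)
  then have "Poly_Mapping.keys r \<subseteq> S \<times> UNIV"
    using keys_diff[of "frag_of a - frag_of b" "frag_of c"] keys_diff[of "frag_of a" "frag_of b"]
    by auto
  then show "r \<in> carrier (free_Abelian_group (S \<times> UNIV))" by simp
qed

text \<open>Relations additive in the group component vanish for every D. Those additive in the
  rational component vanish once D clears both denominators, since floors of integers add. As an
  element of the generated subgroup involves finitely many relations, a product of denominators
  works; it depends on z, which is why d is chosen after z.\<close>

lemma scaled_sum_tensor_relations:
  fixes S :: "'g::ab_group_add set"
  assumes "z \<in> generate (free_Abelian_group (S \<times> UNIV))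
                 (tensor_relations \<lparr>carrier = S, monoid.mult = (+), one = 0\<rparr> rational_group)"
    and "\<And>x y. x \<in> S \<Longrightarrow> y \<in> S \<Longrightarrow> x + y \<in> S"
  shows "\<exists>d>0. \<forall>D. d dvd D \<longrightarrow> scaled_sum D z = 0"
proof -
  let ?R = "tensor_relations \<lparr>carrier = S, monoid.mult = (+), one = 0\<rparr> rational_group"
  have rel: "\<exists>d>0. \<forall>D. d dvd D \<longrightarrow> scaled_sum D r = 0" if "r \<in> ?R" for r
  proof -
    from that consider
      x y q where "r = frag_of (x + y, q) - frag_of (x, q) - frag_of (y, q)"
    | x p q where "r = frag_of (x, p + q) - frag_of (x, p) - frag_of (x, q)"
      by (auto simp: tensor_relations_def rational_group_def)
    then show ?thesis
    proof cases
      case 1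
      then show ?thesis
        by (intro exI[of _ 1]) (simp add: scaled_sum_diff scaled_sum_frag_of int_mult_add_right)
    next
      case 2
      obtain d where d: "d > 0" "\<And>D. d dvd D \<Longrightarrow> of_nat D * p \<in> \<int>"
        by (rule rat_common_denominator) blast
      obtain e where e: "e > 0" "\<And>D. e dvd D \<Longrightarrow> of_nat D * q \<in> \<int>"
        by (rule rat_common_denominator) blast
      have "scaled_sum D r = 0" if "d * e dvd D" for D
      proof -
        have "of_nat D * p \<in> \<int>" "of_nat D * q \<in> \<int>"
          using d e that by (auto intro: dvd_mult_left dvd_mult_right)
        then show ?thesis
          by (auto simp: 2 scaled_sum_diff scaled_sum_frag_of distrib_left int_mult_add_left
              elim!: Ints_cases simp flip: of_int_add)
      qed
      with d e show ?thesis by (intro exI[of _ "d * e"]) auto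
    qed
  qed
  have keys: "Poly_Mapping.keys r \<subseteq> S \<times> UNIV" if "r \<in> ?R" for r
    using that tensor_relations_subset[of S, OF assms(2)] by fastforce
  from assms(1) show ?thesis
  proof induction
    case one
    show ?case by (intro exI[of _ 1]) (simp add: scaled_sum_def)
  next
    case (incl r)
    then show ?case by (rule rel)
  next
    case (inv r)
    then show ?case
      using rel[OF inv] keys[OF inv] by (simp add: scaled_sum_minus)
  next
    case (eng r s)
    then obtain d e where "d > 0" "e > 0" "\<forall>D. d dvd D \<longrightarrow> scaled_sum D r = 0"
      "\<forall>D. e dvd D \<longrightarrow> scaled_sum D s = 0"
      by blast
    then show ?case
      by (intro exI[of _ "d * e"]) (auto simp: scaled_sum_add intro: dvd_mult_left dvd_mult_right)
  qed
qed

text \<open>The map is x \<mapsto> x \<otimes> 1 followed by the given isomorphism. If x \<otimes> 1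
  vanishes, \<open>scaled_sum\<close> yields d x = 0 for some d > 0, and an ordered group has no
  torsion.\<close>

lemma rank_one_embedding:
  fixes S :: "'g::linordered_ab_group_add set"
  defines "M \<equiv> \<lparr>carrier = S, monoid.mult = (+), one = 0\<rparr>"
  assumes add: "\<And>x y. x \<in> S \<Longrightarrow> y \<in> S \<Longrightarrow> x + y \<in> S"
    and iso: "tensor_group M rational_group \<cong> rational_group"
  obtains \<psi> :: "'g \<Rightarrow> rat"
  where "\<forall>x\<in>S. \<forall>y\<in>S. \<psi> (x + y) = \<psi> x + \<psi> y"
    and "\<forall>x\<in>S. \<psi> x = 0 \<longrightarrow> x = 0"
proof -
  define F where "F = free_Abelian_group (S \<times> (UNIV :: rat set))"
  define N where "N = generate F (tensor_relations M rational_group)"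
  interpret F: comm_group F
    unfolding F_def by (rule abelian_free_Abelian_group)
  have rel_sub: "tensor_relations M rational_group \<subseteq> carrier F"
    unfolding M_def F_def by (rule tensor_relations_subset[OF add])
  have sub: "subgroup N F"
    unfolding N_def by (rule F.generate_is_subgroup[OF rel_sub])
  then interpret N: normal N F
    by (rule F.subgroup_imp_normal)
  have T: "tensor_group M rational_group = F Mod N"
    by (simp add: tensor_group_def F_def N_def M_def rational_group_def)
  obtain h where h: "h \<in> Group.iso (F Mod N) rational_group"
    using iso by (auto simp: T is_iso_def)
  \<comment> \<open>The isomorphism lifted to formal sums. Its kernel is exactly N, so vanishing of
    a tensor turns into membership in the subgroup of relations.\<close>
  define \<Phi> where "\<Phi> z = h (N #>\<^bsub>F\<^esub> z)" for z
  have "\<Phi> \<in> hom F rational_group"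
    using hom_compose[OF N.r_coset_hom_Mod, of h] h
    by (auto simp: \<Phi>_def[abs_def] Group.iso_def comp_def)
  then have \<Phi>_add: "\<Phi> (z + w) = \<Phi> z + \<Phi> w" if "z \<in> carrier F" "w \<in> carrier F" for z w
    using that by (auto simp: hom_def rational_group_def F_def)
  have \<Phi>_0: "\<Phi> 0 = 0"
    using \<Phi>_add[of 0 0] by (simp add: F_def)
  have \<Phi>_iff: "\<Phi> z = 0 \<longleftrightarrow> z \<in> N" if z: "z \<in> carrier F" for z
  proof
    assume "z \<in> N"
    then have "N #>\<^bsub>F\<^esub> z = N #>\<^bsub>F\<^esub> 0"
      using F.coset_join2[OF z sub] F.coset_join2[OF _ sub, of 0] N.one_closed by (simp add: F_def)
    then show "\<Phi> z = 0" using \<Phi>_0 by (simp add: \<Phi>_def)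
  next
    assume "\<Phi> z = 0"
    then have "h (N #>\<^bsub>F\<^esub> z) = h (N #>\<^bsub>F\<^esub> 0)"
      using \<Phi>_0 by (simp add: \<Phi>_def)
    moreover have "N #>\<^bsub>F\<^esub> z \<in> carrier (F Mod N)" "N #>\<^bsub>F\<^esub> 0 \<in> carrier (F Mod N)"
      using z by (auto simp: F_def FactGroup_def RCOSETS_def)
    ultimately have "N #>\<^bsub>F\<^esub> z = N #>\<^bsub>F\<^esub> 0"
      using h by (auto simp: Group.iso_def bij_betw_def dest: inj_onD)
    then show "z \<in> N"
      using F.rcos_self[OF z sub] F.coset_join2[OF _ sub, of 0] N.one_closed by (simp add: F_def)
  qed
  define \<psi> where "\<psi> x = \<Phi> (frag_of (x, 1))" for x
  show thesis
  proof (rule that; intro ballI impI)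
    fix x y assume xy: "x \<in> S" "y \<in> S"
    let ?r = "frag_of (x + y, 1) - frag_of (x, 1) - frag_of (y, 1) :: ('g \<times> rat) \<Rightarrow>\<^sub>0 int"
    have "?r \<in> tensor_relations M rational_group"
      using xy by (fastforce simp: tensor_relations_def M_def rational_group_def)
    then have r: "?r \<in> N" "?r \<in> carrier F"
      using rel_sub by (auto simp: N_def intro: generate.incl)
    have c: "frag_of (u, 1) \<in> carrier F" if "u \<in> S" for u
      using that by (simp add: F_def)
    let ?s = "frag_of (x, 1) + frag_of (y, 1) :: ('g \<times> rat) \<Rightarrow>\<^sub>0 int"
    have "?s \<in> carrier F"
      using F.m_closed[OF c[OF xy(1)] c[OF xy(2)]] by (simp add: F_def)
    then have "\<Phi> (?r + ?s) = \<Phi> ?r + \<Phi> ?s"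
      by (rule \<Phi>_add[OF r(2)])
    moreover have "?r + ?s = frag_of (x + y, 1)" by simp
    moreover have "\<Phi> ?r = 0" using \<Phi>_iff[OF r(2)] r(1) by blast
    moreover have "\<Phi> ?s = \<psi> x + \<psi> y" using \<Phi>_add c xy by (simp add: \<psi>_def)
    ultimately show "\<psi> (x + y) = \<psi> x + \<psi> y"
      by (simp add: \<psi>_def)
  next
    fix x assume x: "x \<in> S" "\<psi> x = 0"
    then have "frag_of (x, 1) \<in> N"
      using \<Phi>_iff[of "frag_of (x, 1)"] by (simp add: \<psi>_def F_def)
    then obtain d where d: "d > 0" "scaled_sum d (frag_of (x, 1 :: rat)) = 0"
      using scaled_sum_tensor_relations[of "frag_of (x, 1)" S] add
      by (auto simp: N_def M_def F_def)
    then show "x = 0"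
      using nat_mult_eq_0_iff[of d x] by (simp add: scaled_sum_frag_of int_mult_of_nat)
  qed
qed

section \<open>Valuations\<close>

locale field_valuation =
  fixes v :: "'a::field \<Rightarrow> 'g::linordered_ab_group_add"
  assumes valuation: "valuation_on UNIV v"
begin

lemma v_mult: "x \<noteq> 0 \<Longrightarrow> y \<noteq> 0 \<Longrightarrow> v (x * y) = v x + v y"
  using valuation by (auto simp: valuation_on_def)

lemma v_add_ge: "x \<noteq> 0 \<Longrightarrow> y \<noteq> 0 \<Longrightarrow> x + y \<noteq> 0 \<Longrightarrow> v (x + y) \<ge> min (v x) (v y)"
  using valuation by (auto simp: valuation_on_def)

lemma v_1 [simp]: "v 1 = 0"
  using v_mult[of 1 1] by simp

lemma v_uminus: "x \<noteq> 0 \<Longrightarrow> v (- x) = v x"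
proof -
  have "nat_mult 2 (v (- 1)) = 0"
    using v_mult[of "- 1" "- 1"] by (simp add: numeral_2_eq_2)
  then have "v (- 1) = 0"
    by (simp add: nat_mult_eq_0_iff)
  then show "x \<noteq> 0 \<Longrightarrow> v (- x) = v x"
    using v_mult[of "- 1" x] by simp
qed

lemma v_divide: "x \<noteq> 0 \<Longrightarrow> y \<noteq> 0 \<Longrightarrow> v (x / y) = v x - v y"
  using v_mult[of "x / y" y] by (simp add: eq_diff_eq)

lemma v_power: "x \<noteq> 0 \<Longrightarrow> v (x ^ n) = nat_mult n (v x)"
  by (induction n) (simp_all add: v_mult add.commute)

lemma v_prod: "(\<And>x. x \<in> S \<Longrightarrow> f x \<noteq> 0) \<Longrightarrow> v (prod f S) = (\<Sum>x\<in>S. v (f x))"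
  by (induction S rule: infinite_finite_induct) (simp_all add: v_mult)

lemma v_add_less:
  assumes "x \<noteq> 0" "y \<noteq> 0" "v x < v y"
  shows "x + y \<noteq> 0" "v (x + y) = v x"
proof -
  show *: "x + y \<noteq> 0"
  proof
    assume "x + y = 0"
    then have "x = - y" by (simp add: eq_neg_iff_add_eq_0)
    with assms v_uminus[of y] show False by simp
  qed
  have "v (x + y) \<ge> v x"
    using v_add_ge[of x y] assms * by simp
  moreover have "v x \<ge> min (v (x + y)) (v y)"
    using v_add_ge[of "x + y" "- y"] v_uminus[of y] assms * by simp
  then have "v x \<ge> v (x + y)"
    using assms(3) by (metis min_le_iff_disj not_le)
  ultimately show "v (x + y) = v x" by simp
qed

lemma v_add_distinct:
  assumes "x \<noteq> 0" "y \<noteq> 0" "v x \<noteq> v y"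
  shows "x + y \<noteq> 0" "v (x + y) = min (v x) (v y)"
proof -
  have "x + y \<noteq> 0 \<and> v (x + y) = min (v x) (v y)"
  proof (cases "v x < v y")
    case True
    with assms v_add_less[of x y] show ?thesis by simp
  next
    case False
    with assms v_add_less[of y x] show ?thesis by (simp add: add.commute min_def)
  qed
  then show "x + y \<noteq> 0" "v (x + y) = min (v x) (v y)" by auto
qed

lemma v_add_ge_bound:
  assumes "x = 0 \<or> v x \<ge> B" "y = 0 \<or> v y \<ge> B"
  shows "x + y = 0 \<or> v (x + y) \<ge> B"
proof (cases "x = 0 \<or> y = 0 \<or> x + y = 0")
  case False
  with assms have "B \<le> min (v x) (v y)" by simp
  also have "\<dots> \<le> v (x + y)" using False by (intro v_add_ge) auto
  finally show ?thesis ..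
qed (use assms in auto)

lemma v_add_gt_bound:
  assumes "x = 0 \<or> v x > B" "y = 0 \<or> v y > B"
  shows "x + y = 0 \<or> v (x + y) > B"
proof (cases "x = 0 \<or> y = 0 \<or> x + y = 0")
  case False
  with assms have "B < min (v x) (v y)" by simp
  also have "\<dots> \<le> v (x + y)" using False by (intro v_add_ge) auto
  finally show ?thesis ..
qed (use assms in auto)

lemma v_sum_gt:
  assumes "\<And>i. i \<in> I \<Longrightarrow> f i = 0 \<or> v (f i) > B"
  shows "sum f I = 0 \<or> v (sum f I) > B"
  using assms by (induction I rule: infinite_finite_induct) (simp_all add: v_add_gt_bound)

section \<open>The set of values and its embedding into the rationals\<close>

abbreviation "vals \<equiv> v ` (UNIV - {0})"

lemma v_mem_vals: "x \<noteq> 0 \<Longrightarrow> v x \<in> vals"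
  by blast

lemma vals_add: "a \<in> vals \<Longrightarrow> b \<in> vals \<Longrightarrow> a + b \<in> vals"
  by (auto simp flip: v_mult)

lemma vals_diff: "a \<in> vals \<Longrightarrow> b \<in> vals \<Longrightarrow> a - b \<in> vals"
  by (auto simp flip: v_divide)

lemma vals_nat_mult: "a \<in> vals \<Longrightarrow> nat_mult q a \<in> vals"
  by (auto simp flip: v_power)

text \<open>An injective additive map from an ordered group to the rationals preserves or reverses
  the order. Dividing by its value at a positive element selects the first case.\<close>

lemma rational_rank_one_embedding:
  assumes "rational_rank_one UNIV v" and "\<gamma> \<in> vals" and "\<gamma> > 0"
  obtains \<rho> :: "'g \<Rightarrow> rat"
  where "\<And>a b. a \<in> vals \<Longrightarrow> b \<in> vals \<Longrightarrow> \<rho> (a + b) = \<rho> a + \<rho> b"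
    and "\<And>a b. a \<in> vals \<Longrightarrow> b \<in> vals \<Longrightarrow> \<rho> a < \<rho> b \<longleftrightarrow> a < b"
    and "\<rho> \<gamma> = 1"
proof -
  have iso: "tensor_group \<lparr>carrier = vals, monoid.mult = (+), one = 0\<rparr> rational_group
      \<cong> rational_group"
    using assms(1) by (simp add: rational_rank_one_def value_group_def)
  obtain \<psi> :: "'g \<Rightarrow> rat" where
    \<psi>: "\<forall>x\<in>vals. \<forall>y\<in>vals. \<psi> (x + y) = \<psi> x + \<psi> y" "\<forall>x\<in>vals. \<psi> x = 0 \<longrightarrow> x = 0"
    by (rule rank_one_embedding[OF _ iso], erule vals_add, assumption) (rule that)
  then have add: "\<psi> (x + y) = \<psi> x + \<psi> y" if "x \<in> vals" "y \<in> vals" for x y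
    using that by blast
  have inj: "x = 0" if "x \<in> vals" "\<psi> x = 0" for x
    using \<psi> that by blast
  have zero: "\<psi> 0 = 0"
    using add[of 0 0] v_mem_vals[of 1] by simp
  have mult: "\<psi> (nat_mult q a) = of_nat q * \<psi> a" if "a \<in> vals" for q a
    using that by (induction q) (simp_all add: zero add vals_nat_mult distrib_right)
  have g: "\<psi> \<gamma> \<noteq> 0" using inj[OF assms(2)] assms(3) by fastforce
  define \<rho> where "\<rho> a = \<psi> a / \<psi> \<gamma>" for a
  have pos: "\<rho> a > 0" if a: "a \<in> vals" "a > 0" for a
  proof (rule ccontr)
    assume "\<not> \<rho> a > 0"
    then have neg: "- \<rho> a \<ge> 0" by simp
    obtain p q where pq: "quotient_of (- \<rho> a) = (p, q)" by fastforce
    have q: "q > 0" using quotient_of_denom_pos[OF pq] .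
    have eq: "- \<rho> a = of_int p / of_int q" using quotient_of_div[OF pq] .
    with neg q have p: "p \<ge> 0" by (simp add: zero_le_divide_iff)
    \<comment> \<open>With \<open>\<rho> a = - p / q\<close> and p \<ge> 0, the element q a + p
      \<gamma> is positive in the value group but killed by \<psi>, against injectivity.\<close>
    have "\<psi> (nat_mult (nat q) a + nat_mult (nat p) \<gamma>) = of_int q * \<psi> a + of_int p * \<psi> \<gamma>"
      using a assms p q by (simp add: add vals_nat_mult mult)
    also have "\<dots> = (of_int q * \<rho> a + of_int p) * \<psi> \<gamma>"
      using g by (simp add: \<rho>_def distrib_right)
    also have "of_int q * \<rho> a + of_int p = of_int p - of_int q * (- \<rho> a)"
      by simp
    also have "\<dots> = 0"
      using q by (simp only: eq) simp
    finally have "\<psi> (nat_mult (nat q) a + nat_mult (nat p) \<gamma>) = 0" by simp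
    then have "nat_mult (nat q) a + nat_mult (nat p) \<gamma> = 0"
      by (intro inj vals_add vals_nat_mult a assms)
    moreover have "nat_mult (nat q) a > 0" "nat_mult (nat p) \<gamma> \<ge> 0"
      using a assms q by (auto intro: nat_mult_pos nat_mult_nonneg)
    ultimately show False
      using add_pos_nonneg by fastforce
  qed
  have \<rho>_add: "\<rho> (a + b) = \<rho> a + \<rho> b" if "a \<in> vals" "b \<in> vals" for a b
    using add[OF that] by (simp add: \<rho>_def add_divide_distrib)
  have mono: "\<rho> a < \<rho> b" if "a < b" "a \<in> vals" "b \<in> vals" for a b
    using pos[of "b - a"] \<rho>_add[of a "b - a"] vals_diff that by simp
  show thesis
  proof
    show "\<rho> a < \<rho> b \<longleftrightarrow> a < b" if "a \<in> vals" "b \<in> vals" for a b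
      using mono[of a b] mono[of b a] that by (cases a b rule: linorder_cases) auto
  qed (use g \<rho>_add in \<open>auto simp: \<rho>_def\<close>)
qed

end

section \<open>Generating sequences\<close>

lemma const2_eq_0_iff [simp]: "const2 c = 0 \<longleftrightarrow> c = 0"
  by (simp add: const2_def)

lemma varX_neq_0 [simp]: "varX \<noteq> 0" and varY_neq_0 [simp]: "varY \<noteq> 0"
  by (simp_all add: varX_def varY_def)

locale dominating_valuation = field_valuation v
  for v :: "'k::field poly poly fract \<Rightarrow> 'g::linordered_ab_group_add" +
  assumes dominates: "valuation_dominates UNIV v (localization UNIV maxideal_XY)"
begin

abbreviation "val f \<equiv> v (emb f)"

lemma val_mult: "f \<noteq> 0 \<Longrightarrow> g \<noteq> 0 \<Longrightarrow> val (f * g) = val f + val g"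
  by (simp add: emb_mult v_mult)

lemma val_nonneg: "f \<noteq> 0 \<Longrightarrow> val f \<ge> 0"
  using dominates UNIV.emb_mem_loc[of f]
  by (auto simp: valuation_dominates_def valuation_ring_def UNIV_loc)

lemma val_pos_iff:
  assumes "f \<noteq> 0"
  shows "val f > 0 \<longleftrightarrow> origin_eval f = 0"
proof -
  have "val f > 0 \<longleftrightarrow> emb f \<in> valuation_ideal UNIV v \<inter> UNIV.loc"
    using assms UNIV.emb_mem_loc[of f] by (simp add: valuation_ideal_def)
  also have "\<dots> \<longleftrightarrow> emb f \<in> nonunits UNIV.loc"
    using dominates by (simp add: valuation_dominates_def UNIV_loc)
  also have "\<dots> \<longleftrightarrow> origin_eval f = 0"
    using UNIV.nonunits_loc_iff[of f 1] by simp
  finally show ?thesis .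
qed

lemma val_eq_0_iff: "f \<noteq> 0 \<Longrightarrow> val f = 0 \<longleftrightarrow> origin_eval f \<noteq> 0"
  using val_pos_iff[of f] val_nonneg[of f] by auto

lemma val_const2: "c \<noteq> 0 \<Longrightarrow> val (const2 c) = 0"
  by (simp add: val_eq_0_iff)

lemma val_varX_pos: "val varX > 0"
  by (simp add: val_pos_iff) (simp add: origin_eval_def varX_def)

end

text \<open>The laws of \<rho> are confined to \<open>vals\<close> because nothing is known of it
  elsewhere. Normalizing at X gives \<open>\<gamma> 0\<close> the denominator 1, where the count of
  denominators starts.\<close>

locale generating_valuation = dominating_valuation v
  for v :: "'k::field poly poly fract \<Rightarrow> 'g::linordered_ab_group_add" +
  fixes Q :: "nat \<Rightarrow> 'k poly poly" and \<rho> :: "'g \<Rightarrow> rat"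
  assumes generating: "generating_sequence v Q"
    and \<rho>_add: "a \<in> vals \<Longrightarrow> b \<in> vals \<Longrightarrow> \<rho> (a + b) = \<rho> a + \<rho> b"
    and \<rho>_less_iff: "a \<in> vals \<Longrightarrow> b \<in> vals \<Longrightarrow> \<rho> a < \<rho> b \<longleftrightarrow> a < b"
    and \<rho>_varX: "\<rho> (val varX) = 1"
begin

abbreviation "\<gamma> \<equiv> \<lambda>l. val (Q l)"

abbreviation "mb \<equiv> mbar \<gamma>"

lemma Q_0: "Q 0 = varX" and Q_1: "Q 1 = varY"
  using generating by (simp_all add: generating_sequence_def Let_def)

lemma Q_SucE:
  assumes "l \<ge> 1"
  obtains c lam where "\<And>k. 1 \<le> k \<Longrightarrow> k < l \<Longrightarrow> c k < mb k"
    "nat_mult (mb l) (\<gamma> l) = (\<Sum>k<l. nat_mult (c k) (\<gamma> k))"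
    "lam \<noteq> 0" "Q (Suc l) = Q l ^ mb l - const2 lam * (\<Prod>k<l. Q k ^ c k)"
    "\<gamma> (Suc l) > nat_mult (mb l) (\<gamma> l)"
proof -
  have "\<exists>(c :: nat \<Rightarrow> nat) lam. (\<forall>k. 1 \<le> k \<and> k < l \<longrightarrow> c k < mb k) \<and>
      nat_mult (mb l) (\<gamma> l) = (\<Sum>k<l. nat_mult (c k) (\<gamma> k)) \<and> lam \<noteq> 0 \<and>
      Q (Suc l) = Q l ^ mb l - const2 lam * (\<Prod>k<l. Q k ^ c k) \<and>
      \<gamma> (Suc l) > nat_mult (mb l) (\<gamma> l)"
    using generating assms unfolding generating_sequence_def Let_def by simp
  then show thesis using that by blast
qed

lemma \<rho>_gamma_0: "\<rho> (\<gamma> 0) = 1"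
  by (simp only: Q_0 \<rho>_varX)

lemma zero_mem_vals: "0 \<in> vals"
  using v_mem_vals[of 1] by simp

lemma \<rho>_0 [simp]: "\<rho> 0 = 0"
  using \<rho>_add[OF zero_mem_vals zero_mem_vals] by simp

lemma \<rho>_eq_iff: "a \<in> vals \<Longrightarrow> b \<in> vals \<Longrightarrow> \<rho> a = \<rho> b \<longleftrightarrow> a = b"
  using \<rho>_less_iff[of a b] \<rho>_less_iff[of b a] by (cases a b rule: linorder_cases) simp_all

lemma \<rho>_nat_mult: "a \<in> vals \<Longrightarrow> \<rho> (nat_mult q a) = of_nat q * \<rho> a"
  by (induction q) (simp_all add: \<rho>_add vals_nat_mult distrib_right)

lemma vals_sum: "(\<And>i. i \<in> I \<Longrightarrow> f i \<in> vals) \<Longrightarrow> sum f I \<in> vals"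
  by (induction I rule: infinite_finite_induct) (simp_all add: vals_add zero_mem_vals)

lemma \<rho>_sum: "(\<And>i. i \<in> I \<Longrightarrow> f i \<in> vals) \<Longrightarrow> \<rho> (sum f I) = (\<Sum>i\<in>I. \<rho> (f i))"
  by (induction I rule: infinite_finite_induct) (simp_all add: \<rho>_add vals_sum)

section \<open>Groups generated by the initial values\<close>

definition zspan :: "nat \<Rightarrow> 'g set" where
  "zspan l = {\<Sum>k<l. int_mult (a k) (\<gamma> k) | a. True}"

lemma spanI: "(\<Sum>k<l. int_mult (a k) (\<gamma> k)) \<in> zspan l"
  unfolding zspan_def by blast

lemma span_diff:
  assumes "x \<in> zspan l" "y \<in> zspan l"
  shows "x - y \<in> zspan l"
proof -
  from assms obtain a b where
    "x = (\<Sum>k<l. int_mult (a k) (\<gamma> k))" "y = (\<Sum>k<l. int_mult (b k) (\<gamma> k))"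
    unfolding zspan_def by blast
  then have "x - y = (\<Sum>k<l. int_mult (a k - b k) (\<gamma> k))"
    by (simp add: int_mult_diff_left sum_subtractf)
  then show ?thesis by (simp only: spanI)
qed

lemma zero_mem_span: "0 \<in> zspan l"
  using spanI[where a = "\<lambda>_. 0"] by simp

lemma span_add: "x \<in> zspan l \<Longrightarrow> y \<in> zspan l \<Longrightarrow> x + y \<in> zspan l"
  using span_diff[of x l "0 - y"] span_diff[of 0 l y] zero_mem_span by simp

lemma span_nat_mult: "x \<in> zspan l \<Longrightarrow> nat_mult q x \<in> zspan l"
  by (induction q) (simp_all add: zero_mem_span span_add)

lemma int_mult_gamma_mem_span: "k < l \<Longrightarrow> int_mult b (\<gamma> k) \<in> zspan l"
  using spanI[of "\<lambda>i. if i = k then b else 0" l]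
  by (simp add: if_distrib[of "\<lambda>a. int_mult a _"] sum.delta cong: if_cong)

lemma gamma_mem_span: "k < l \<Longrightarrow> \<gamma> k \<in> zspan l"
  using int_mult_gamma_mem_span[of k l 1] by simp

lemma span_mono: "x \<in> zspan l \<Longrightarrow> x \<in> zspan (Suc l)"
proof -
  assume "x \<in> zspan l"
  then obtain a where "x = (\<Sum>k<l. int_mult (a k) (\<gamma> k))"
    unfolding zspan_def by blast
  then have "x = (\<Sum>k<Suc l. int_mult ((a(l := 0)) k) (\<gamma> k))"
    by simp
  then show ?thesis using spanI by metis
qed

lemma mbar_alt: "mb l = (LEAST q. q > 0 \<and> nat_mult q (\<gamma> l) \<in> zspan l)"
  unfolding mbar_def zspan_def by (rule arg_cong[of _ _ Least]) auto

text \<open>The least element exists: if \<rho> sends \<open>\<gamma> l\<close> to p/q, then q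
  \<open>\<gamma> l\<close> = p \<open>\<gamma> 0\<close>, because \<rho> is injective with
  \<open>\<rho> (\<gamma> 0) = 1\<close>. That \<open>Q l\<close> is nonzero stays a hypothesis, as
  it is established in the induction on degrees that uses this lemma.\<close>

lemma mbar_pos:
  assumes "l \<ge> 1" "Q l \<noteq> 0"
  shows "mb l > 0"
proof -
  have in_vals: "\<gamma> l \<in> vals" "\<gamma> 0 \<in> vals"
    using assms by (auto simp: Q_0)
  have nonneg: "\<rho> (\<gamma> l) \<ge> 0"
    using \<rho>_less_iff[OF in_vals(1) zero_mem_vals] val_nonneg[OF assms(2)]
    by (simp flip: not_less)
  obtain p q where pq: "quotient_of (\<rho> (\<gamma> l)) = (p, q)" by fastforce
  have q: "q > 0" using quotient_of_denom_pos[OF pq] .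
  have eq: "\<rho> (\<gamma> l) = of_int p / of_int q" using quotient_of_div[OF pq] .
  with nonneg q have p: "p \<ge> 0" by (simp add: zero_le_divide_iff)
  have "\<rho> (nat_mult (nat q) (\<gamma> l)) = \<rho> (nat_mult (nat p) (\<gamma> 0))"
    using q p eq by (simp add: \<rho>_nat_mult in_vals \<rho>_gamma_0)
  then have "nat_mult (nat q) (\<gamma> l) = nat_mult (nat p) (\<gamma> 0)"
    by (rule \<rho>_eq_iff[OF vals_nat_mult vals_nat_mult, OF in_vals, THEN iffD1])
  moreover have "nat_mult (nat p) (\<gamma> 0) \<in> zspan l"
    using assms by (intro span_nat_mult gamma_mem_span) simp
  ultimately have "nat q > 0 \<and> nat_mult (nat q) (\<gamma> l) \<in> zspan l"
    using q by simp
  then show ?thesis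
    unfolding mbar_alt by (rule LeastI2) simp
qed

lemma nat_mult_gamma_notin_span: "0 < s \<Longrightarrow> s < mb l \<Longrightarrow> nat_mult s (\<gamma> l) \<notin> zspan l"
  using not_less_Least[of s "\<lambda>q. q > 0 \<and> nat_mult q (\<gamma> l) \<in> zspan l"] by (simp add: mbar_alt)

section \<open>Degrees in Y of the generating sequence\<close>

lemma Q_Suc_aux:
  assumes "l \<ge> 1" "lead_coeff (Q l) = 1"
    and prod: "\<And>c. (\<forall>k. 1 \<le> k \<and> k < l \<longrightarrow> c k < mb k) \<Longrightarrow>
      degree (\<Prod>k<l. Q k ^ c k) < degree (Q l)"
  shows "lead_coeff (Q (Suc l)) = 1 \<and> degree (Q (Suc l)) = mb l * degree (Q l)"
proof -
  have "Q l \<noteq> 0" using assms(2) by auto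
  then have m: "mb l > 0" using mbar_pos assms(1) by simp
  obtain c lam where c: "\<And>k. 1 \<le> k \<Longrightarrow> k < l \<Longrightarrow> c k < mb k"
    and Q: "Q (Suc l) = Q l ^ mb l - const2 lam * (\<Prod>k<l. Q k ^ c k)"
    using assms(1) by (rule Q_SucE) blast
  define P where "P = const2 lam * (\<Prod>k<l. Q k ^ c k)"
  have "degree P \<le> degree (const2 lam) + degree (\<Prod>k<l. Q k ^ c k)"
    unfolding P_def by (rule degree_mult_le)
  also have "\<dots> < degree (Q l)"
    using prod[of c] c by (simp add: const2_def)
  also have "\<dots> \<le> degree (Q l ^ mb l)"
    using \<open>Q l \<noteq> 0\<close> m by (simp add: degree_power_eq)
  finally have less: "degree P < degree (Q l ^ mb l)" .
  have Q': "Q (Suc l) = Q l ^ mb l + - P"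
    by (simp add: Q P_def)
  have deg: "degree (Q (Suc l)) = degree (Q l ^ mb l)"
    unfolding Q' by (rule degree_add_eq_left) (simp add: less)
  have "coeff (Q (Suc l)) (degree (Q l ^ mb l)) = lead_coeff (Q l ^ mb l)"
    unfolding Q' by (simp add: less coeff_eq_0)
  also have "\<dots> = 1"
    by (simp only: lead_coeff_power assms(2) power_one)
  finally show ?thesis
    using deg \<open>Q l \<noteq> 0\<close> by (simp add: degree_power_eq)
qed

text \<open>The bound on products works as in a mixed radix system: the digits satisfy c k < mb k
  and the place values are the degrees, so every number written with digits below place l is less
  than that place value. The exponent of \<open>Q 0 = X\<close> is free since X has degree 0 in Y.
  The bound makes the subtracted product in the recursion too small to affect the leading
  term.\<close>

lemma Q_monic_aux:
  "l \<ge> 1 \<Longrightarrow> lead_coeff (Q l) = 1 \<and> degree (Q l) > 0 \<and>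
    (\<forall>c. (\<forall>k. 1 \<le> k \<and> k < l \<longrightarrow> c k < mb k) \<longrightarrow> degree (\<Prod>k<l. Q k ^ c k) < degree (Q l))"
proof (induction l rule: nat_induct_at_least)
  case base
  have "degree (varX ^ e) = 0" for e
    using degree_power_le[of varX e] by (simp add: varX_def)
  then have "degree (Q 0 ^ e) = 0" for e
    by (simp only: Q_0)
  moreover have "lead_coeff (Q 1) = 1" "degree (Q 1) = 1"
    by (simp_all only: Q_1) (simp_all add: varY_def)
  ultimately show ?case by simp
next
  case (Suc l)
  have Suc_l: "lead_coeff (Q (Suc l)) = 1 \<and> degree (Q (Suc l)) = mb l * degree (Q l)"
    by (rule Q_Suc_aux) (use Suc in auto)
  from Suc have Q: "Q l \<noteq> 0" "degree (Q l) > 0" by auto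
  have "degree (\<Prod>k<Suc l. Q k ^ c k) < degree (Q (Suc l))"
    if c: "\<forall>k. 1 \<le> k \<and> k < Suc l \<longrightarrow> c k < mb k" for c
  proof -
    have "degree (\<Prod>k<l. Q k ^ c k) < degree (Q l)"
      using Suc.IH c by simp
    moreover have "degree (\<Prod>k<Suc l. Q k ^ c k)
        \<le> degree (\<Prod>k<l. Q k ^ c k) + degree (Q l ^ c l)"
      using degree_mult_le by simp
    ultimately have "degree (\<Prod>k<Suc l. Q k ^ c k) < degree (Q l) + c l * degree (Q l)"
      using Q(1) by (simp add: degree_power_eq)
    also have "\<dots> = Suc (c l) * degree (Q l)" by simp
    also have "\<dots> \<le> mb l * degree (Q l)"
      using c Suc.hyps by (intro mult_le_mono1) (simp add: Suc_leI)
    finally show ?thesis by (simp only: Suc_l)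
  qed
  moreover have "degree (Q (Suc l)) > 0"
    using Suc_l Q mbar_pos Suc.hyps by simp
  ultimately show ?case
    using Suc_l by blast
qed

lemma Q_monic: "l \<ge> 1 \<Longrightarrow> lead_coeff (Q l) = 1"
  and degree_Q_pos: "l \<ge> 1 \<Longrightarrow> degree (Q l) > 0"
  using Q_monic_aux[of l] by auto

lemma Q_neq_0: "Q l \<noteq> 0"
  using Q_monic[of l] by (cases l) (auto simp: Q_0)

lemma gamma_mem_vals: "\<gamma> l \<in> vals"
  using Q_neq_0 by auto

lemma mbar_pos': "l \<ge> 1 \<Longrightarrow> mb l > 0"
  using mbar_pos Q_neq_0 by simp

lemma degree_Q_Suc: "l \<ge> 1 \<Longrightarrow> degree (Q (Suc l)) = mb l * degree (Q l)"
  using Q_monic_aux[of l] Q_Suc_aux[of l] by blast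

section \<open>Denominators and growth of the values\<close>

lemma gamma_nonneg: "\<gamma> l \<ge> 0"
  by (simp add: val_nonneg Q_neq_0)

lemma \<rho>_nonneg: "a \<in> vals \<Longrightarrow> a \<ge> 0 \<Longrightarrow> \<rho> a \<ge> 0"
  using \<rho>_less_iff[OF _ zero_mem_vals, of a] by (simp flip: not_less)

lemma \<rho>_gamma_Suc:
  assumes "l \<ge> 1"
  shows "\<rho> (\<gamma> (Suc l)) > of_nat (mb l) * \<rho> (\<gamma> l)"
proof -
  have "\<gamma> (Suc l) > nat_mult (mb l) (\<gamma> l)"
    using assms by (rule Q_SucE)
  then have "\<rho> (\<gamma> (Suc l)) > \<rho> (nat_mult (mb l) (\<gamma> l))"
    by (rule \<rho>_less_iff[OF vals_nat_mult[OF gamma_mem_vals] gamma_mem_vals, THEN iffD2])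
  then show ?thesis
    by (simp add: \<rho>_nat_mult gamma_mem_vals)
qed

lemma degree_Q_1: "degree (Q 1) = 1"
  by (simp only: Q_1) (simp add: varY_def)

text \<open>Passing from l to l + 1 multiplies the degree by \<open>mb l\<close>, and
  \<open>mb l\<close> times the new value is a combination of earlier ones. So the degree always
  absorbs the new denominator.\<close>

lemma \<rho>_gamma_denominator:
  "l \<ge> 1 \<Longrightarrow> k < l \<Longrightarrow> of_nat (degree (Q l)) * \<rho> (\<gamma> k) \<in> \<int>"
proof (induction l arbitrary: k rule: nat_induct_at_least)
  case base
  then show ?case using degree_Q_1 \<rho>_gamma_0 by simp
next
  case (Suc l)
  have Q: "of_nat (degree (Q (Suc l))) = (of_nat (mb l) * of_nat (degree (Q l)) :: rat)"
    using degree_Q_Suc Suc.hyps by simp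
  show ?case
  proof (cases "k < l")
    case True
    then show ?thesis
      using Suc.IH[of k] by (simp add: Q mult.assoc)
  next
    case False
    with Suc.prems have k: "k = l" by simp
    obtain c where "nat_mult (mb l) (\<gamma> l) = (\<Sum>k<l. nat_mult (c k) (\<gamma> k))"
      using Suc.hyps by (rule Q_SucE)
    then have "\<rho> (nat_mult (mb l) (\<gamma> l)) = \<rho> (\<Sum>k<l. nat_mult (c k) (\<gamma> k))"
      by (rule arg_cong)
    then have "of_nat (mb l) * \<rho> (\<gamma> l) = (\<Sum>k<l. of_nat (c k) * \<rho> (\<gamma> k))"
      by (simp only: \<rho>_sum \<rho>_nat_mult gamma_mem_vals vals_nat_mult)
    then have "of_nat (degree (Q l)) * (of_nat (mb l) * \<rho> (\<gamma> l)) =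
        (\<Sum>k<l. of_nat (c k) * (of_nat (degree (Q l)) * \<rho> (\<gamma> k)))"
      by (simp add: sum_distrib_left mult_ac)
    also have "\<dots> \<in> \<int>"
      by (intro Ints_sum Ints_mult Ints_of_nat Suc.IH) auto
    finally show ?thesis
      by (simp add: Q k mult_ac)
  qed
qed

text \<open>If the degrees of the \<open>Q l\<close> are unbounded, the values grow at least proportionally to them;
  otherwise the values eventually increase within a group with bounded denominators.\<close>
lemma gamma_unbounded:
  assumes "b \<in> vals"
  obtains l where "l \<ge> 1" "\<gamma> l > b"
proof -
  have "\<exists>l\<ge>1. \<rho> (\<gamma> l) > \<rho> b"
  proof (cases "\<exists>D. \<forall>l\<ge>1. degree (Q l) \<le> D")
    case True
    then obtain D where D: "\<And>l. l \<ge> 1 \<Longrightarrow> degree (Q l) \<le> D" by blast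
    \<comment> \<open>All degrees are at most D and hence divide the factorial of D, so E clears the
      denominators of all values at once.\<close>
    define E :: rat where "E = of_nat (fact D)"
    have E: "E > 0" by (simp add: E_def)
    have int: "E * \<rho> (\<gamma> l) \<in> \<int>" for l
    proof -
      have "degree (Q (Suc l)) dvd fact D"
        using D[of "Suc l"] degree_Q_pos[of "Suc l"] by (intro dvd_fact) auto
      then obtain e where "fact D = degree (Q (Suc l)) * e" by blast
      then have "E * \<rho> (\<gamma> l) = of_nat e * (of_nat (degree (Q (Suc l))) * \<rho> (\<gamma> l))"
        by (simp add: E_def mult_ac)
      also have "\<dots> \<in> \<int>"
        by (intro Ints_mult Ints_of_nat \<rho>_gamma_denominator) auto
      finally show ?thesis .
    qed
    have step: "E * \<rho> (\<gamma> (Suc l)) \<ge> E * \<rho> (\<gamma> l) + 1" if l: "l \<ge> 1" for l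
    proof -
      have "\<rho> (\<gamma> l) \<le> of_nat (mb l) * \<rho> (\<gamma> l)"
        using mbar_pos'[OF l] \<rho>_nonneg[OF gamma_mem_vals gamma_nonneg, of l]
          mult_right_mono[of 1 "of_nat (mb l)" "\<rho> (\<gamma> l)"]
        by simp
      also have "\<dots> < \<rho> (\<gamma> (Suc l))" by (rule \<rho>_gamma_Suc[OF l])
      finally have "E * \<rho> (\<gamma> l) < E * \<rho> (\<gamma> (Suc l))" using E by simp
      moreover obtain p where "E * \<rho> (\<gamma> l) = of_int p"
        using int by (rule Ints_cases)
      moreover obtain q where "E * \<rho> (\<gamma> (Suc l)) = of_int q"
        using int by (rule Ints_cases)
      ultimately have "p < q" "E * \<rho> (\<gamma> l) = of_int p" "E * \<rho> (\<gamma> (Suc l)) = of_int q"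
        by simp_all
      moreover from \<open>p < q\<close> have "of_int (p + 1) \<le> (of_int q :: rat)"
        by (subst of_int_le_iff) simp
      ultimately show ?thesis by simp
    qed
    have growth: "E * \<rho> (\<gamma> (Suc l)) \<ge> of_nat l" for l
    proof (induction l)
      case 0
      show ?case using E \<rho>_nonneg[OF gamma_mem_vals gamma_nonneg] by simp
    next
      case (Suc l)
      then show ?case using step[of "Suc l"] by simp
    qed
    obtain l where "E * \<rho> b < of_nat l" using reals_Archimedean2 by blast
    then have "E * \<rho> b < E * \<rho> (\<gamma> (Suc l))" using growth[of l] by linarith
    with E show ?thesis by (intro exI[of _ "Suc l"]) simp
  next
    case False
    have Y: "\<rho> (\<gamma> 1) > 0"
    proof -
      have "\<gamma> 1 > 0"
        by (simp only: Q_1) (simp add: val_pos_iff origin_eval_def varY_def)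
      then show ?thesis
        using \<rho>_less_iff[OF zero_mem_vals gamma_mem_vals] by simp
    qed
    \<comment> \<open>Degree and value are both multiplied by \<open>mb l\<close>, the value by
      strictly more, so the ratio of value to degree never falls below its initial value.\<close>
    have growth: "l \<ge> 1 \<Longrightarrow> \<rho> (\<gamma> l) \<ge> of_nat (degree (Q l)) * \<rho> (\<gamma> 1)" for l
    proof (induction l rule: nat_induct_at_least)
      case base
      show ?case using degree_Q_1 by simp
    next
      case (Suc l)
      have "of_nat (mb l) * (of_nat (degree (Q l)) * \<rho> (\<gamma> 1)) \<le> of_nat (mb l) * \<rho> (\<gamma> l)"
        using Suc by (intro mult_left_mono) auto
      also have "\<dots> < \<rho> (\<gamma> (Suc l))" using Suc by (intro \<rho>_gamma_Suc)
      finally show ?case using degree_Q_Suc[OF Suc.hyps] by (simp add: mult.assoc)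
    qed
    obtain D where D: "\<rho> b / \<rho> (\<gamma> 1) < of_nat D" using reals_Archimedean2 by blast
    from False obtain l where l: "l \<ge> 1" "D < degree (Q l)" by (meson not_le)
    have "\<rho> b < of_nat D * \<rho> (\<gamma> 1)"
      using D Y by (simp add: divide_less_eq)
    also have "\<dots> \<le> of_nat (degree (Q l)) * \<rho> (\<gamma> 1)"
      using l Y by (intro mult_right_mono) auto
    also have "\<dots> \<le> \<rho> (\<gamma> l)" by (rule growth[OF l(1)])
    finally show ?thesis using l by blast
  qed
  then obtain l where "l \<ge> 1" "\<rho> (\<gamma> l) > \<rho> b" by blast
  then show thesis
    using that[of l] \<rho>_less_iff[OF assms gamma_mem_vals, of l] by simp
qed

section \<open>Invariance of values under one element of the group\<close>

context
  fixes g :: "'k \<times> 'k"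
  assumes nonzero: "fst g \<noteq> 0" "snd g \<noteq> 0"
    and eigen: "\<And>l. \<exists>c. act g (Q l) = const2 c * Q l"
begin

lemma act_nonzero: "f \<noteq> 0 \<Longrightarrow> act g f \<noteq> 0"
  using act_eq_0_iff[OF nonzero] by blast

lemma val_act_Q_mult:
  assumes "f \<noteq> 0" "val (act g f) = val f"
  shows "val (act g (Q l * f)) = \<gamma> l + val f"
proof -
  obtain c where c: "act g (Q l) = const2 c * Q l" using eigen by blast
  then have "c \<noteq> 0" using act_nonzero[OF Q_neq_0, of l] by auto
  then show ?thesis
    using assms act_nonzero[OF assms(1)] Q_neq_0[of l]
    by (simp add: act.map_mult c val_mult val_const2)
qed

text \<open>Factors X are split off until the constant term is nonzero; then the polynomial and its
  translate are both units at the origin.\<close>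

lemma val_act_degree_0:
  assumes "p \<noteq> 0"
  shows "val [:p:] \<in> zspan 1 \<and> val (act g [:p:]) = val [:p:]"
  using assms
proof (induction p)
  case (pCons c p)
  show ?case
  proof (cases "c = 0")
    case False
    have "act g [:pCons c p:] \<noteq> 0" using False by (intro act_nonzero) simp
    moreover have "origin_eval (act g [:pCons c p:]) = c"
      using coeff_act[of g "[:pCons c p:]" 0 0] by (simp add: origin_eval_def poly_0_coeff_0)
    moreover have "origin_eval [:pCons c p:] = c"
      by (simp add: origin_eval_def)
    ultimately have "val (act g [:pCons c p:]) = 0" "val [:pCons c p:] = 0"
      using False by (simp_all add: val_eq_0_iff)
    then show ?thesis using zero_mem_span by simp
  next
    case True
    with pCons.hyps have p: "p \<noteq> 0" by auto
    have eq: "[:pCons c p:] = Q 0 * [:p:]"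
      using True by (simp only: Q_0) (simp add: varX_def)
    have IH: "val [:p:] \<in> zspan 1" "val (act g [:p:]) = val [:p:]"
      using pCons.IH[OF p] by auto
    have "val (Q 0 * [:p:]) = \<gamma> 0 + val [:p:]"
      using p Q_neq_0 by (intro val_mult) auto
    moreover have "val (act g (Q 0 * [:p:])) = \<gamma> 0 + val [:p:]"
      using p IH by (intro val_act_Q_mult) auto
    moreover have "\<gamma> 0 + val [:p:] \<in> zspan 1"
      by (intro span_add gamma_mem_span IH) simp
    ultimately show ?thesis
      unfolding eq by simp
  qed
qed simp

text \<open>The two claims support each other: that remainders have values in \<open>zspan l\<close>
  is what keeps the terms of an expansion in powers of \<open>Q l\<close> apart, and terms with
  distinct values make the value of the translate computable.\<close>

lemma val_act_low_degree:
  assumes "l \<ge> 1" "f \<noteq> 0" "degree f < degree (Q l)"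
  shows "val f \<in> zspan l \<and> val (act g f) = val f"
  using assms
proof (induction l arbitrary: f rule: nat_induct_at_least)
  case base
  then have "degree f = 0" by (simp only: degree_Q_1)
  then obtain p where "f = [:p:]" by (metis degree_eq_zeroE)
  with base.prems val_act_degree_0[of p] show ?case by simp
next
  case (Suc l)
  note outer = Suc.IH and l = Suc.hyps
  have dpos: "degree (Q l) > 0" by (rule degree_Q_pos[OF Suc.hyps])
  \<comment> \<open>The expansion in powers of \<open>Q l\<close> in Horner form: k bounds the
    number of digits, and s is the position of the digit that attains the minimum.\<close>
  have "(\<exists>s<k. \<exists>u\<in>zspan l. val f = u + nat_mult s (\<gamma> l)) \<and> val (act g f) = val f"
    if "k \<le> mb l" "f \<noteq> 0" "degree f < k * degree (Q l)" for k f
    using that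
  proof (induction k arbitrary: f)
    case (Suc k)
    obtain q r where qr: "f = Q l * q + r" "r = 0 \<or> degree r < degree (Q l)"
      by (rule monic_division[OF Q_monic[OF l]])
    have low: "val r \<in> zspan l \<and> val (act g r) = val r" if "r \<noteq> 0"
      using outer[of r] qr(2) that by simp
    \<comment> \<open>The extracted factor \<open>Q l\<close> raises s by one, so 0 < s < mb l. By
      minimality of \<open>mb l\<close> the value of this summand then lies outside
      \<open>zspan l\<close>, unlike that of r.\<close>
    have high: "(\<exists>s\<le>k. \<exists>u\<in>zspan l. s > 0 \<and> val (Q l * q) = u + nat_mult s (\<gamma> l)) \<and>
        val (act g (Q l * q)) = val (Q l * q)" if q: "q \<noteq> 0"
    proof -
      have "degree r < Suc k * degree (Q l)"
        using qr(2) dpos by auto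
      then have "degree (f - r) < Suc k * degree (Q l)"
        using Suc.prems by (intro degree_diff_less)
      then have "degree q < k * degree (Q l)"
        using qr(1) q Q_neq_0 by (simp add: degree_mult_eq)
      then obtain s u where su: "s < k" "u \<in> zspan l" "val q = u + nat_mult s (\<gamma> l)"
        and act_q: "val (act g q) = val q"
        using Suc.IH[of q] Suc.prems q by auto
      have "val (Q l * q) = u + nat_mult (Suc s) (\<gamma> l)"
        using q su Q_neq_0 by (simp add: val_mult algebra_simps)
      moreover have "val (act g (Q l * q)) = val (Q l * q)"
        using q act_q Q_neq_0 by (simp add: val_act_Q_mult val_mult)
      ultimately show ?thesis
        using su(1,2) by (intro conjI exI[of _ "Suc s"] bexI[of _ u]) simp_all
    qed
    consider "q = 0" | "q \<noteq> 0" "r = 0" | "q \<noteq> 0" "r \<noteq> 0" by blast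
    then show ?case
    proof cases
      case 1
      with qr Suc.prems low show ?thesis
        by (intro exI[of _ 0] conjI bexI[of _ "val r"]) simp_all
    next
      case 2
      then have "f = Q l * q" using qr(1) by simp
      with high[OF 2(1)] show ?thesis by (auto simp only: less_Suc_eq_le)
    next
      case 3
      obtain s u where su: "s \<le> k" "u \<in> zspan l" "s > 0" "val (Q l * q) = u + nat_mult s (\<gamma> l)"
        using high 3 by blast
      have "nat_mult s (\<gamma> l) \<notin> zspan l"
        using su Suc.prems by (intro nat_mult_gamma_notin_span) auto
      then have neq: "val (Q l * q) \<noteq> val r"
      proof (rule contrapos_nn)
        assume "val (Q l * q) = val r"
        then have "nat_mult s (\<gamma> l) = val r - u" using su(4) by (simp add: eq_diff_eq add.commute)
        then show "nat_mult s (\<gamma> l) \<in> zspan l" using su(2) low[OF 3(2)] by (simp add: span_diff)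
      qed
      have "val f = min (val (Q l * q)) (val r)"
        unfolding qr(1) emb_add by (rule v_add_distinct) (use 3 Q_neq_0 neq in auto)
      \<comment> \<open>The two translated summands keep their values, which still differ, so the
        minimum is the same as for f.\<close>
      moreover have "val (act g f) = min (val (Q l * q)) (val r)"
      proof -
        have act_eq: "val (act g (Q l * q)) = val (Q l * q)" "val (act g r) = val r"
          using high[OF 3(1)] low[OF 3(2)] by blast+
        have "act g (Q l * q) \<noteq> 0" "act g r \<noteq> 0"
          using 3 Q_neq_0 by (intro act_nonzero; simp)+
        then have "v (emb (act g (Q l * q)) + emb (act g r)) =
            min (val (act g (Q l * q))) (val (act g r))"
          using neq by (intro v_add_distinct) (simp_all only: act_eq emb_eq_0_iff not_False_eq_True)
        then show ?thesis
          by (simp only: qr(1) act.map_add emb_add act_eq)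
      qed
      moreover have "\<exists>s<Suc k. \<exists>u\<in>zspan l. min (val (Q l * q)) (val r) = u + nat_mult s (\<gamma> l)"
      proof (cases "val (Q l * q) \<le> val r")
        case True
        with su show ?thesis
          by (intro exI[of _ s] conjI bexI[of _ u]) simp_all
      next
        case False
        with low[OF 3(2)] show ?thesis
          by (intro exI[of _ 0] conjI bexI[of _ "val r"]) simp_all
      qed
      ultimately show ?thesis by simp
    qed
  qed simp
  \<comment> \<open>Taking k = mb l gives precisely the degree of \<open>Q (Suc l)\<close> as the
    bound.\<close>
  from this[of "mb l" f] obtain s u
    where "u \<in> zspan l" "val f = u + nat_mult s (\<gamma> l)" "val (act g f) = val f"
    using Suc.prems degree_Q_Suc[OF Suc.hyps] by auto
  then show ?case
    by (simp add: span_add span_mono span_nat_mult gamma_mem_span)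
qed

text \<open>For a \<open>Q l\<close> of sufficiently large value, f and its remainder modulo
  \<open>Q l\<close> have the same value. The translate of \<open>Q l\<close> is a scalar multiple
  of \<open>Q l\<close>, so the same comparison holds after translation, and the remainder has low
  degree.\<close>

lemma val_act:
  assumes "f \<noteq> 0"
  shows "val (act g f) = val f"
proof -
  \<comment> \<open>The value of the translate is still unknown, so l has to be chosen to exceed
    both values.\<close>
  have mem: "max (val f) (val (act g f)) \<in> vals"
    using assms act_nonzero[OF assms] by (simp add: max_def)
  obtain l where l: "l \<ge> 1" and big: "val f < \<gamma> l" "val (act g f) < \<gamma> l"
    using gamma_unbounded[OF mem] by auto
  obtain q r where qr: "f = Q l * q + r" "r = 0 \<or> degree r < degree (Q l)"
    by (rule monic_division[OF Q_monic[OF l]])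
  \<comment> \<open>Stated for arbitrary q and r because it is applied twice: to the division of f,
    and to its translate, whose quotient acquires the eigenvalue c.\<close>
  have rem: "r \<noteq> 0 \<and> val r = val (Q l * q + r)"
    if "q \<noteq> 0" "Q l * q + r \<noteq> 0" "val (Q l * q + r) < \<gamma> l" for q r
  proof -
    have "\<gamma> l \<le> val (Q l * q)"
      using that(1) by (simp add: val_mult Q_neq_0 val_nonneg)
    then have "val (Q l * q + r) < val (- (Q l * q))"
      using that(1) v_uminus[of "emb (Q l * q)"] that(3) by (simp add: emb.map_uminus Q_neq_0)
    moreover have "- (Q l * q) \<noteq> 0" using that(1) Q_neq_0 by simp
    ultimately show ?thesis
      using v_add_less[of "emb (Q l * q + r)" "emb (- (Q l * q))"] that(2)
      by (simp flip: emb_add)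
  qed
  show ?thesis
  proof (cases "q = 0")
    case True
    with qr assms val_act_low_degree[OF l] show ?thesis by simp
  next
    case q: False
    obtain c where c: "act g (Q l) = const2 c * Q l" using eigen by blast
    then have "c \<noteq> 0" using act_nonzero[OF Q_neq_0, of l] by auto
    have act_f: "act g f = Q l * (const2 c * act g q) + act g r"
      by (simp add: qr act.map_add act.map_mult c mult_ac)
    have r: "r \<noteq> 0" "val r = val f"
      using rem[OF q] assms big qr by auto
    have "val (act g r) = val (act g f)"
      using rem[of "const2 c * act g q" "act g r"] act_nonzero[OF q] act_nonzero[OF assms] big \<open>c \<noteq> 0\<close>
      by (simp flip: act_f)
    moreover have "val (act g r) = val r"
      using val_act_low_degree[OF l r(1)] qr r by simp
    ultimately show ?thesis using r by simp
  qed
qed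

end

end

section \<open>Extensions of an invariant valuation\<close>

context field_valuation
begin

text \<open>Valuation rings are integrally closed: if z had negative value, each term with k < N
  would have value strictly above that of \<open>z ^ N\<close>.\<close>

lemma integral_nonneg:
  assumes "z \<noteq> 0" "z ^ N = (\<Sum>k<N. c k * z ^ k)" "\<And>k. k < N \<Longrightarrow> c k = 0 \<or> v (c k) \<ge> 0"
  shows "v z \<ge> 0"
proof (rule ccontr)
  assume "\<not> v z \<ge> 0"
  then have neg: "- v z > 0" by simp
  have "c k * z ^ k = 0 \<or> v (c k * z ^ k) > nat_mult N (v z)" if "k \<in> {..<N}" for k
  proof (cases "c k = 0")
    case False
    have "nat_mult (N - k) (- v z) > 0" using neg that by (intro nat_mult_pos) auto
    moreover have "nat_mult N (v z) = nat_mult k (v z) + nat_mult (N - k) (v z)"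
      using that by (simp flip: nat_mult_add_left)
    ultimately have "nat_mult N (v z) < nat_mult k (v z)"
      by (simp add: nat_mult_uminus)
    moreover have "v (c k) \<ge> 0" using assms(3)[of k] False that by simp
    ultimately have "nat_mult N (v z) < v (c k) + nat_mult k (v z)"
      by (rule add_strict_increasing2[rotated])
    then show ?thesis using False assms(1) by (simp add: v_mult v_power)
  qed simp
  then have "z ^ N = 0 \<or> v (z ^ N) > nat_mult N (v z)"
    unfolding assms(2) by (rule v_sum_gt)
  with assms(1) show False by (simp add: v_power)
qed

text \<open>Each coefficient is a sum of products of \<open>card S\<close> entries, all of value at
  least \<open>v c\<close>. With c a common denominator, this is the bound that survives division by
  the leading coefficient.\<close>

lemma coeff_prod_linear_ge:
  assumes "finite S" "\<And>g. g \<in> S \<Longrightarrow> b g = 0 \<or> v (b g) \<ge> v c" "c \<noteq> 0"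
  shows "coeff (\<Prod>g\<in>S. [:b g, c:]) k = 0 \<or>
    v (coeff (\<Prod>g\<in>S. [:b g, c:]) k) \<ge> nat_mult (card S) (v c)"
  using assms(1,2)
proof (induction S arbitrary: k rule: finite_induct)
  case empty
  show ?case by (simp add: coeff_1)
next
  case (insert g S)
  define p where "p = (\<Prod>g\<in>S. [:b g, c:])"
  have bound: "x * coeff p k = 0 \<or> v (x * coeff p k) \<ge> nat_mult (Suc (card S)) (v c)"
    if "x = 0 \<or> v x \<ge> v c" for x k
  proof (cases "x = 0 \<or> coeff p k = 0")
    case False
    then have "nat_mult (card S) (v c) + v c \<le> v (coeff p k) + v x"
      using insert.IH[of k] insert.prems that by (intro add_mono) (auto simp: p_def)
    then show ?thesis using False by (simp add: v_mult add.commute)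
  qed auto
  have "(\<Prod>g\<in>insert g S. [:b g, c:]) = smult (b g) p + pCons 0 (smult c p)"
    using insert.hyps by (simp add: p_def)
  moreover have "coeff (pCons 0 (smult c p)) k = 0 \<or>
      v (coeff (pCons 0 (smult c p)) k) \<ge> nat_mult (Suc (card S)) (v c)"
    using bound[of c] by (cases k) simp_all
  moreover have "coeff (smult (b g) p) k = 0 \<or>
      v (coeff (smult (b g) p) k) \<ge> nat_mult (Suc (card S)) (v c)"
    using bound[of "b g" k] insert.prems by simp
  ultimately show ?case
    using insert.hyps v_add_ge_bound
    by (simp only: coeff_add card_insert_disjoint not_False_eq_True)
qed

end

text \<open>Applied to quotients y / x, the two conditions on signs compare the values of any two
  elements, which determines an isomorphism between value groups of different types.\<close>

lemma valuation_equiv_UNIV: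
  fixes v :: "'a::field \<Rightarrow> 'g::linordered_ab_group_add" and w :: "'a \<Rightarrow> 'h::linordered_ab_group_add"
  assumes "valuation_on UNIV v" "valuation_on UNIV w"
    and nonneg: "\<And>z. z \<noteq> 0 \<Longrightarrow> v z \<ge> 0 \<Longrightarrow> w z \<ge> 0"
    and pos: "\<And>z. z \<noteq> 0 \<Longrightarrow> v z > 0 \<Longrightarrow> w z > 0"
  shows "valuation_equiv UNIV v w"
proof -
  interpret v: field_valuation v by unfold_locales fact
  interpret w: field_valuation w by unfold_locales fact
  \<comment> \<open>Any preimage of a serves, since \<open>le\<close> in both directions shows that
    equal values under v force equal values under w.\<close>
  define \<phi> where "\<phi> a = w (SOME z. z \<noteq> 0 \<and> v z = a)" for a
  have le: "w x \<le> w y" if "x \<noteq> 0" "y \<noteq> 0" "v x \<le> v y" for x y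
    using nonneg[of "y / x"] that by (simp add: v.v_divide w.v_divide)
  have less: "w x < w y" if "x \<noteq> 0" "y \<noteq> 0" "v x < v y" for x y
    using pos[of "y / x"] that by (simp add: v.v_divide w.v_divide)
  have \<phi>: "\<phi> (v z) = w z" if "z \<noteq> 0" for z
  proof -
    define y where "y = (SOME y. y \<noteq> 0 \<and> v y = v z)"
    have "y \<noteq> 0 \<and> v y = v z"
      unfolding y_def by (rule someI[of _ z]) (use that in simp)
    then have "w y = w z"
      using that by (intro antisym le) simp_all
    then show ?thesis by (simp add: \<phi>_def y_def)
  qed
  have mono: "strict_mono_on v.vals \<phi>"
  proof (rule strict_mono_onI)
    fix a b assume "a \<in> v.vals" "b \<in> v.vals" "a < b"
    then obtain x y where "x \<noteq> 0" "y \<noteq> 0" "a = v x" "b = v y" by blast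
    with less[of x y] \<open>a < b\<close> show "\<phi> a < \<phi> b" by (simp add: \<phi>)
  qed
  have image: "\<phi> ` v.vals = w.vals"
    unfolding image_image by (rule image_cong) (simp_all add: \<phi>)
  have "\<phi> \<in> Group.iso (value_group UNIV v) (value_group UNIV w)"
    unfolding Group.iso_def hom_def bij_betw_def
  proof (intro CollectI conjI)
    show "inj_on \<phi> (carrier (value_group UNIV v))"
      using mono by (simp add: value_group_def strict_mono_on_imp_inj_on)
    show "\<phi> ` carrier (value_group UNIV v) = carrier (value_group UNIV w)"
      using image by (simp add: value_group_def)
    show "\<phi> \<in> carrier (value_group UNIV v) \<rightarrow> carrier (value_group UNIV w)"
      using image by (intro funcsetI) (simp add: value_group_def flip: image)
    show "\<forall>x\<in>carrier (value_group UNIV v). \<forall>y\<in>carrier (value_group UNIV v).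
        \<phi> (x \<otimes>\<^bsub>value_group UNIV v\<^esub> y) = \<phi> x \<otimes>\<^bsub>value_group UNIV w\<^esub> \<phi> y"
    proof (intro ballI)
      fix a b assume "a \<in> carrier (value_group UNIV v)" "b \<in> carrier (value_group UNIV v)"
      then obtain x y where xy: "x \<noteq> 0" "y \<noteq> 0" "a = v x" "b = v y"
        by (auto simp: value_group_def)
      then have "\<phi> (a + b) = \<phi> (v (x * y))" by (simp add: v.v_mult)
      also have "\<dots> = \<phi> a + \<phi> b" using xy by (subst \<phi>) (simp_all add: \<phi> w.v_mult)
      finally show "\<phi> (a \<otimes>\<^bsub>value_group UNIV v\<^esub> b) = \<phi> a \<otimes>\<^bsub>value_group UNIV w\<^esub> \<phi> b"
        by (simp add: value_group_def)
    qed
  qed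
  then show ?thesis
    unfolding valuation_equiv_def using mono by (intro bexI[of _ \<phi>]) (simp_all add: \<phi>)
qed

section \<open>Norms and conjugates over the invariant field\<close>

locale invariant_valuation = dominating_valuation v
  for v :: "'k::field poly poly fract \<Rightarrow> 'g::linordered_ab_group_add" +
  fixes H :: "('k \<times> 'k) set"
  assumes finite_H: "finite H"
    and one_mem_H: "(1, 1) \<in> H"
    and mult_mem_H: "g \<in> H \<Longrightarrow> h \<in> H \<Longrightarrow> (fst g * fst h, snd g * snd h) \<in> H"
    and nonzero_H: "g \<in> H \<Longrightarrow> fst g \<noteq> 0 \<and> snd g \<noteq> 0"
    and val_act_H: "g \<in> H \<Longrightarrow> f \<noteq> 0 \<Longrightarrow> val (act g f) = val f"
begin

lemma invariant_iff: "f \<in> invariants H \<longleftrightarrow> (\<forall>g\<in>H. act g f = f)"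
  by (simp add: invariants_def)

sublocale poly_subring "invariants H"
  by unfold_locales (simp_all add: invariant_iff act.map_diff act.map_mult)

abbreviation "L \<equiv> quotient_field (emb ` invariants H)"

lemma act_nonzero_H: "g \<in> H \<Longrightarrow> f \<noteq> 0 \<Longrightarrow> act g f \<noteq> 0"
  using nonzero_H act_eq_0_iff by blast

text \<open>Translation is injective because the components of h are nonzero, and an injective
  self-map of a finite set is onto.\<close>

lemma bij_betw_mult_H:
  assumes "h \<in> H"
  shows "bij_betw (\<lambda>g. (fst h * fst g, snd h * snd g)) H H"
proof -
  have "inj_on (\<lambda>g. (fst h * fst g, snd h * snd g)) H"
    using nonzero_H[OF assms] by (auto simp: inj_on_def prod_eq_iff)
  moreover have "(\<lambda>g. (fst h * fst g, snd h * snd g)) ` H \<subseteq> H"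
    using mult_mem_H[OF assms] by blast
  ultimately show ?thesis
    using finite_H by (simp add: bij_betw_def endo_inj_surj)
qed

definition orbit_norm :: "'k poly poly \<Rightarrow> 'k poly poly" where
  "orbit_norm f = (\<Prod>g\<in>H. act g f)"

lemma orbit_norm_invariant: "orbit_norm f \<in> invariants H"
  unfolding invariant_iff
proof
  fix h assume h: "h \<in> H"
  have "act h (orbit_norm f) = (\<Prod>g\<in>H. act (fst h * fst g, snd h * snd g) f)"
    by (simp add: orbit_norm_def act.map_prod act_act)
  also have "\<dots> = orbit_norm f"
    unfolding orbit_norm_def by (rule prod.reindex_bij_betw[OF bij_betw_mult_H[OF h]])
  finally show "act h (orbit_norm f) = orbit_norm f" .
qed

lemma orbit_norm_nonzero: "f \<noteq> 0 \<Longrightarrow> orbit_norm f \<noteq> 0"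
  using finite_H act_nonzero_H by (simp add: orbit_norm_def)

lemma val_orbit_norm: "f \<noteq> 0 \<Longrightarrow> val (orbit_norm f) = nat_mult (card H) (val f)"
proof -
  assume f: "f \<noteq> 0"
  have "val (orbit_norm f) = (\<Sum>g\<in>H. val (act g f))"
    unfolding orbit_norm_def emb.map_prod using f act_nonzero_H by (intro v_prod) simp
  also have "\<dots> = (\<Sum>g\<in>H. val f)"
    using f val_act_H by (intro sum.cong) auto
  \<comment> \<open>An enumeration of H is needed because \<open>nat_mult\<close> sums over an
    initial segment of the naturals.\<close>
  also have "\<dots> = (\<Sum>_<card H. val f)"
    by (rule sum.reindex_bij_betw[symmetric, OF bij_betw_from_nat_into_finite, OF finite_H, unfolded atLeast0LessThan])
  finally show ?thesis by (simp add: nat_mult_def)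
qed

text \<open>For invariant nonzero d this is \<open>d ^ card H\<close> times the monic polynomial
  whose roots are the conjugates of a / d. Clearing the denominator keeps the coefficients in R,
  where the action is defined.\<close>

definition orbit_poly :: "'k poly poly \<Rightarrow> 'k poly poly \<Rightarrow> 'k poly poly poly" where
  "orbit_poly a d = (\<Prod>g\<in>H. [:- act g a, d:])"

text \<open>Acting by h on the coefficients fixes d and merely permutes the linear factors.\<close>

lemma coeff_orbit_poly_invariant:
  assumes "d \<in> invariants H"
  shows "coeff (orbit_poly a d) k \<in> invariants H"
  unfolding invariant_iff
proof
  fix h assume h: "h \<in> H"
  interpret poly_act: ring_map "map_poly (act h)"
    by (rule act.ring_map_map_poly)
  have d: "act h d = d" using assms h by (simp add: invariant_iff)
  have "map_poly (act h) (orbit_poly a d) =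
      (\<Prod>g\<in>H. [:- act (fst h * fst g, snd h * snd g) a, d:])"
    unfolding orbit_poly_def poly_act.map_prod
    by (simp add: map_poly_pCons act.map_uminus act_act d)
  also have "\<dots> = orbit_poly a d"
    unfolding orbit_poly_def
    by (rule prod.reindex_bij_betw[OF bij_betw_mult_H[OF h], of "\<lambda>g. [:- act g a, d:]"])
  finally have "coeff (map_poly (act h) (orbit_poly a d)) k = coeff (orbit_poly a d) k"
    by simp
  then show "act h (coeff (orbit_poly a d) k) = coeff (orbit_poly a d) k"
    by (simp add: coeff_map_poly)
qed

lemma quotient_mem_L: "f \<in> invariants H \<Longrightarrow> g \<in> invariants H \<Longrightarrow> g \<noteq> 0 \<Longrightarrow> emb f / emb g \<in> L"
  unfolding quotient_field_def
  by (intro CollectI exI[of _ "emb f"] exI[of _ "emb g"] conjI imageI) simp_all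

lemma power_invariant: "f \<in> invariants H \<Longrightarrow> f ^ n \<in> invariants H"
  by (induction n) (simp_all add: one_mem mult_mem)

lemma uminus_invariant: "f \<in> invariants H \<Longrightarrow> - f \<in> invariants H"
  using diff_mem[of 0 f] zero_mem by simp

text \<open>The fraction is expanded by the remaining conjugates of its denominator, which turns the
  denominator into a norm.\<close>

lemma fract_invariant_denominator:
  assumes "z \<noteq> 0"
  obtains a d where "z = emb a / emb d" "a \<noteq> 0" "d \<noteq> 0" "d \<in> invariants H"
proof -
  obtain a b where z: "z = emb a / emb b" "b \<noteq> 0" by (rule fract_eq_quotient)
  have a: "a \<noteq> 0" using z assms by auto
  let ?c = "\<Prod>g\<in>H - {(1, 1)}. act g b"
  have norm: "orbit_norm b = b * ?c"
    unfolding orbit_norm_def using prod.remove[OF finite_H one_mem_H, of "\<lambda>g. act g b"] by simp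
  then have c: "?c \<noteq> 0" using orbit_norm_nonzero[OF z(2)] by auto
  have "z = emb (a * ?c) / emb (orbit_norm b)"
    unfolding norm z using c by (simp add: emb_mult del: prod_zero_iff)
  then show thesis
    using a c orbit_norm_nonzero[OF z(2)] orbit_norm_invariant
    by (intro that[of "a * ?c" "orbit_norm b"]) (simp_all del: prod_zero_iff)
qed

text \<open>The equation is \<open>orbit_poly a d\<close> at a / d, divided by its leading
  coefficient. The conjugates of a have the value of a, at least that of d, so every coefficient has
  value at least \<open>card H\<close> times that of d, and the division leaves it
  nonnegative.\<close>

lemma integral_equation:
  assumes "a \<noteq> 0" "d \<noteq> 0" "d \<in> invariants H" "v (emb a / emb d) \<ge> 0"
  obtains c where "(emb a / emb d) ^ card H = (\<Sum>k<card H. c k * (emb a / emb d) ^ k)"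
    "\<And>k. c k \<in> L" "\<And>k. c k = 0 \<or> v (c k) \<ge> 0"
proof -
  define z where "z = emb a / emb d"
  define N where "N = card H"
  define P where "P = (\<Prod>g\<in>H. [:- emb (act g a), emb d:])"
  define c where "c k = - coeff P k / emb d ^ N" for k
  have le: "val d \<le> val a"
    using assms by (simp add: v_divide)
  interpret poly_emb: ring_map "map_poly (emb :: 'k poly poly \<Rightarrow> _)"
    by (rule emb.ring_map_map_poly)
  have P: "P = map_poly emb (orbit_poly a d)"
    unfolding P_def orbit_poly_def poly_emb.map_prod by (simp add: map_poly_pCons emb.map_uminus)
  have degree_P: "degree P = N"
    using assms(2) by (simp add: P_def degree_prod_eq_sum_degree N_def)
  have lead_P: "coeff P N = emb d ^ N"
  proof -
    have "lead_coeff P = emb d ^ N"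
      using assms(2) by (simp add: P_def lead_coeff_prod N_def)
    then show ?thesis by (simp add: degree_P)
  qed
  \<comment> \<open>The factor belonging to the identity of H is the one that vanishes at a /
    d.\<close>
  have "poly P z = 0"
    unfolding P_def poly_prod
    by (rule prod_zero[OF finite_H]) (use one_mem_H assms(2) in \<open>auto simp: z_def intro!: bexI[of _ "(1, 1)"]\<close>)
  then have "(\<Sum>k\<le>N. coeff P k * z ^ k) = 0"
    by (simp add: poly_altdef degree_P)
  then have eq: "emb d ^ N * z ^ N + (\<Sum>k<N. coeff P k * z ^ k) = 0"
    by (simp add: lessThan_Suc_atMost[symmetric] lead_P add.commute)
  have "z ^ N = (\<Sum>k<N. c k * z ^ k)"
  proof -
    have "emb d ^ N * (\<Sum>k<N. c k * z ^ k) = - (\<Sum>k<N. coeff P k * z ^ k)"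
      using assms(2) by (simp add: c_def sum_distrib_left flip: sum_negf)
    also have "\<dots> = emb d ^ N * z ^ N"
      using eq by (simp add: add_eq_0_iff2)
    finally show ?thesis using assms(2) by simp
  qed
  moreover have "c k \<in> L" for k
  proof -
    have "c k = emb (- coeff (orbit_poly a d) k) / emb (d ^ N)"
      by (simp add: c_def P coeff_map_poly emb.map_uminus emb.map_power)
    then show ?thesis
      using assms by (simp only:)
        (intro quotient_mem_L uminus_invariant coeff_orbit_poly_invariant power_invariant, auto)
  qed
  moreover have "c k = 0 \<or> v (c k) \<ge> 0" for k
  proof -
    have "coeff P k = 0 \<or> v (coeff P k) \<ge> nat_mult N (val d)"
      unfolding P_def N_def
    proof (rule coeff_prod_linear_ge[OF finite_H])
      show "- emb (act g a) = 0 \<or> val d \<le> v (- emb (act g a))" if "g \<in> H" for g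
        using that assms(1) le by (simp add: v_uminus act_nonzero_H val_act_H)
    qed (use assms in simp)
    moreover have "v (c k) = v (coeff P k) - nat_mult N (val d)" if "coeff P k \<noteq> 0"
      using v_divide[of "- coeff P k" "emb d ^ N"] that assms(2)
      by (simp only: c_def v_uminus v_power neg_equal_0_iff_equal power_eq_0_iff emb_eq_0_iff
          de_Morgan_conj not_False_eq_True simp_thms)
    ultimately show ?thesis by (cases "coeff P k = 0") (simp_all add: c_def)
  qed
  ultimately show thesis
    using that unfolding z_def N_def by blast
qed

section \<open>Uniqueness of the extension\<close>

lemma extension_nonneg:
  fixes w :: "'k poly poly fract \<Rightarrow> 'h::linordered_ab_group_add"
  assumes "valuation_on UNIV w"
    and agree: "\<And>x. x \<in> L \<Longrightarrow> x \<noteq> 0 \<Longrightarrow> v x \<ge> 0 \<Longrightarrow> w x \<ge> 0"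
    and "z \<noteq> 0" "v z \<ge> 0"
  shows "w z \<ge> 0"
proof -
  interpret w: field_valuation w by unfold_locales fact
  obtain a d where z: "z = emb a / emb d" "a \<noteq> 0" "d \<noteq> 0" "d \<in> invariants H"
    using assms(3) by (rule fract_invariant_denominator)
  obtain c where c: "z ^ card H = (\<Sum>k<card H. c k * z ^ k)"
    "\<And>k. c k \<in> L" "\<And>k. c k = 0 \<or> v (c k) \<ge> 0"
    using integral_equation[OF z(2-4)] assms(4) unfolding z(1) by blast
  show ?thesis
    using agree c by (intro w.integral_nonneg[OF assms(3) c(1)]) blast
qed

text \<open>Integrality alone gives only w z \<ge> 0. Strictness comes from the norm of z, which
  lies in L, where positivity is known, and whose value is \<open>card H\<close> times that of
  z.\<close>

lemma extension_pos:
  fixes w :: "'k poly poly fract \<Rightarrow> 'h::linordered_ab_group_add"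
  assumes "valuation_on UNIV w"
    and agree: "\<And>x. x \<in> L \<Longrightarrow> x \<noteq> 0 \<Longrightarrow> v x \<ge> 0 \<Longrightarrow> w x \<ge> 0"
    and agree': "\<And>x. x \<in> L \<Longrightarrow> x \<noteq> 0 \<Longrightarrow> v x > 0 \<Longrightarrow> w x > 0"
    and "z \<noteq> 0" "v z > 0"
  shows "w z > 0"
proof (rule ccontr)
  interpret w: field_valuation w by unfold_locales fact
  assume "\<not> w z > 0"
  then have neg: "nat_mult (card H) (w z) \<le> 0"
    using nat_mult_mono[of "w z" 0 "card H"] by (simp add: nat_mult_def)
  obtain a d where z: "z = emb a / emb d" "a \<noteq> 0" "d \<noteq> 0" "d \<in> invariants H"
    using assms(4) by (rule fract_invariant_denominator)
  \<comment> \<open>This is the norm of z: since d is invariant, its own norm is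
    \<open>d ^ card H\<close>.\<close>
  define y where "y = emb (orbit_norm a) / emb (d ^ card H)"
  have y: "y \<in> L" "y \<noteq> 0"
    using z orbit_norm_nonzero[of a]
    by (auto simp: y_def intro!: quotient_mem_L orbit_norm_invariant power_invariant)
  have vy: "v y = nat_mult (card H) (v z)"
  proof -
    have "v y = val (orbit_norm a) - v (emb d ^ card H)"
      using z orbit_norm_nonzero[of a] by (simp add: y_def v_divide emb.map_power)
    also have "\<dots> = v (emb a ^ card H) - v (emb d ^ card H)"
      using z by (simp add: val_orbit_norm v_power)
    also have "\<dots> = v (z ^ card H)"
      using z by (simp add: power_divide v_divide)
    finally show ?thesis using assms(4) by (simp add: v_power)
  qed
  have "card H > 0" using finite_H one_mem_H card_gt_0_iff by blast
  then have "w y > 0"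
    using y vy assms(5) by (intro agree') (simp_all add: nat_mult_pos)
  \<comment> \<open>This quotient has value 0 under v but need not lie in L, so the previous lemma
    is what bounds w there; it yields w y \<le> \<open>card H\<close> times w z.\<close>
  moreover have "w (z ^ card H / y) \<ge> 0"
    using vy y assms(4)
    by (intro extension_nonneg[OF assms(1) agree]) (simp_all add: v_divide v_power)
  then have "w y \<le> nat_mult (card H) (w z)"
    using y assms(4) by (simp add: w.v_divide w.v_power)
  ultimately show False using neg by simp
qed

lemma L_mult: "x \<in> L \<Longrightarrow> y \<in> L \<Longrightarrow> x * y \<in> L"
proof -
  assume "x \<in> L" "y \<in> L"
  then obtain a b c d where "x = emb a / emb b" "y = emb c / emb d" "emb b \<noteq> 0" "emb d \<noteq> 0"
    "a \<in> invariants H" "b \<in> invariants H" "c \<in> invariants H" "d \<in> invariants H"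
    unfolding quotient_field_def by blast
  then show ?thesis
    using quotient_mem_L[of "a * c" "b * d"] mult_mem by (simp add: emb_mult)
qed

lemma L_add: "x \<in> L \<Longrightarrow> y \<in> L \<Longrightarrow> x + y \<in> L"
proof -
  assume "x \<in> L" "y \<in> L"
  then obtain a b c d where "x = emb a / emb b" "y = emb c / emb d" "emb b \<noteq> 0" "emb d \<noteq> 0"
    "a \<in> invariants H" "b \<in> invariants H" "c \<in> invariants H" "d \<in> invariants H"
    unfolding quotient_field_def by blast
  then show ?thesis
    using quotient_mem_L[of "a * d + c * b" "b * d"] mult_mem add_mem
    by (simp add: emb_mult emb_add add_frac_eq)
qed

lemma L_1: "1 \<in> L"
  using quotient_mem_L[OF one_mem one_mem] by simp

lemma loc_subset_L: "loc \<subseteq> L"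
  by (auto elim!: locE intro: quotient_mem_L)

text \<open>The valuation v is itself the extension asserted to exist. For another extension w, the
  order isomorphism gives information on signs in L only, and the integrality and norm arguments
  carry it to the whole field.\<close>

lemma does_not_split_invariants:
  "does_not_split TYPE('h::linordered_ab_group_add) loc UNIV.loc (restrict v L)"
proof -
  have L: "quotient_field loc = L" by (rule quotient_field_loc)
  have "valuation_on L (restrict v L)"
    using valuation unfolding valuation_on_def by (simp add: L_mult L_add)
  moreover have "valuation_dominates L (restrict v L) loc"
  proof -
    have sub: "loc \<subseteq> UNIV.loc" "nonunits UNIV.loc \<inter> loc = nonunits loc"
      using ring_dominates_loc by (auto simp: ring_dominates_def)
    have dom: "UNIV.loc \<subseteq> valuation_ring UNIV v" "valuation_ideal UNIV v \<inter> UNIV.loc = nonunits UNIV.loc"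
      using dominates by (simp_all add: valuation_dominates_def UNIV_loc)
    have "valuation_ideal L (restrict v L) \<inter> loc = valuation_ideal UNIV v \<inter> loc"
      using loc_subset_L by (auto simp: valuation_ideal_def)
    also have "\<dots> = nonunits loc" using sub dom by blast
    finally show ?thesis
      using sub dom loc_subset_L by (auto simp: valuation_dominates_def valuation_ring_def)
  qed
  moreover have "valuation_equiv L (restrict v L) v"
  proof -
    have "restrict v L ` (L - {0}) = v ` (L - {0})" by (intro image_cong) auto
    then have "value_group L (restrict v L) = value_group L v" by (simp add: value_group_def)
    then show ?thesis
      unfolding valuation_equiv_def
      by (intro bexI[of _ "\<lambda>x. x"]) (auto simp: iso_set_refl strict_mono_on_def)
  qed
  moreover have "valuation_equiv UNIV v w"
    if w: "valuation_on UNIV w" "valuation_equiv L (restrict v L) w" for w :: "'k poly poly fract \<Rightarrow> 'h"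
  proof -
    interpret w: field_valuation w by unfold_locales fact
    obtain \<phi> where \<phi>: "strict_mono_on (restrict v L ` (L - {0})) \<phi>"
      "\<And>x. x \<in> L - {0} \<Longrightarrow> w x = \<phi> (restrict v L x)"
      using w(2) unfolding valuation_equiv_def by blast
    have less: "w x < w y" if "x \<in> L" "y \<in> L" "x \<noteq> 0" "y \<noteq> 0" "v x < v y" for x y
      using strict_mono_onD[OF \<phi>(1), of "restrict v L x" "restrict v L y"] \<phi>(2) that by simp
    have pos: "w x > 0" if "x \<in> L" "x \<noteq> 0" "v x > 0" for x
      using less[OF L_1, of x] that by simp
    have nonneg: "w x \<ge> 0" if x: "x \<in> L" "x \<noteq> 0" "v x \<ge> 0" for x
    proof (cases "v x = 0")
      case True
      \<comment> \<open>The elements x and 1 of L have the same value under v, and on L the value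
        under w is a function of it.\<close>
      then have "w x = w 1" using \<phi>(2)[of x] \<phi>(2)[of 1] x L_1 by simp
      then show ?thesis by simp
    next
      case False
      with pos x show ?thesis by (simp add: less_imp_le)
    qed
    show ?thesis
    proof (rule valuation_equiv_UNIV[OF valuation w(1)])
      show "w z \<ge> 0" if "z \<noteq> 0" "v z \<ge> 0" for z
        by (rule extension_nonneg[OF w(1) nonneg that])
      show "w z > 0" if "z \<noteq> 0" "v z > 0" for z
        by (rule extension_pos[OF w(1) nonneg pos that])
    qed
  qed
  ultimately show ?thesis
    unfolding does_not_split_def L quotient_field_UNIV_loc
    by (intro conjI exI[of _ v] allI impI local_subring_loc UNIV.local_subring_loc
        ring_dominates_loc valuation dominates[folded UNIV_loc]; blast)
qed

end

section \<open>The subgroups of pairs of roots of unity\<close>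

lemma primitive_root_nonzero: "primitive_root m \<alpha> \<Longrightarrow> \<alpha> \<noteq> 0"
  by (auto simp: primitive_root_def power_0_left)

text \<open>All powers, including those with negative exponent, are roots of Z^m - 1, a nonzero
  polynomial since m > 0.\<close>

lemma finite_powers_primitive_root:
  assumes "primitive_root m \<alpha>"
  shows "finite (range (\<lambda>a::int. \<alpha> powi a))"
proof -
  have m: "m > 0" "\<alpha> ^ m = 1" using assms by (auto simp: primitive_root_def)
  have "(\<alpha> powi a) ^ m = 1" for a
  proof -
    have "(\<alpha> powi a) ^ m = \<alpha> powi (a * int m)"
      by (simp add: power_int_mult)
    also have "\<dots> = (\<alpha> ^ m) powi a"
      by (subst mult.commute) (simp add: power_int_mult)
    finally show ?thesis by (simp add: m)
  qed
  then have "range (\<lambda>a::int. \<alpha> powi a) \<subseteq> {z. poly (monom 1 m - 1) z = 0}"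
    by (auto simp: poly_monom)
  moreover have "monom 1 m - 1 \<noteq> (0 :: 'a poly)"
  proof
    assume "monom 1 m - 1 = (0 :: 'a poly)"
    then have "coeff (monom 1 m - 1 :: 'a poly) m = 0" by simp
    with m(1) show False by (simp add: coeff_1)
  qed
  ultimately show ?thesis
    using poly_roots_finite finite_subset by blast
qed

lemma subgroup_H_props:
  assumes "primitive_root m \<alpha>" "primitive_root n \<beta>"
  shows finite_subgroup_H: "finite (subgroup_H \<alpha> \<beta> i j t x)"
    and one_mem_subgroup_H: "(1, 1) \<in> subgroup_H \<alpha> \<beta> i j t x"
    and mult_mem_subgroup_H: "g \<in> subgroup_H \<alpha> \<beta> i j t x \<Longrightarrow> h \<in> subgroup_H \<alpha> \<beta> i j t x \<Longrightarrow>
      (fst g * fst h, snd g * snd h) \<in> subgroup_H \<alpha> \<beta> i j t x"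
    and nonzero_subgroup_H: "g \<in> subgroup_H \<alpha> \<beta> i j t x \<Longrightarrow> fst g \<noteq> 0 \<and> snd g \<noteq> 0"
proof -
  note nz = assms[THEN primitive_root_nonzero]
  show "finite (subgroup_H \<alpha> \<beta> i j t x)"
    by (rule finite_subset[OF _ finite_cartesian_product[OF assms[THEN finite_powers_primitive_root]]])
      (auto simp: subgroup_H_def)
  show "(1, 1) \<in> subgroup_H \<alpha> \<beta> i j t x"
    unfolding subgroup_H_def by (intro CollectI exI[of _ "0::int"]) simp
  show "g \<in> subgroup_H \<alpha> \<beta> i j t x \<Longrightarrow> fst g \<noteq> 0 \<and> snd g \<noteq> 0"
    using nz by (auto simp: subgroup_H_def)
  assume "g \<in> subgroup_H \<alpha> \<beta> i j t x" "h \<in> subgroup_H \<alpha> \<beta> i j t x"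
  then obtain a b c d :: int where
    g: "g = (\<alpha> powi (a * int i), \<beta> powi (b * int j))" "b mod int t = (a * int x) mod int t" and
    h: "h = (\<alpha> powi (c * int i), \<beta> powi (d * int j))" "d mod int t = (c * int x) mod int t"
    unfolding subgroup_H_def by blast
  have "(b + d) mod int t = ((a + c) * int x) mod int t"
    using mod_add_cong[OF g(2) h(2)] by (simp add: distrib_right)
  moreover have "(fst g * fst h, snd g * snd h) =
      (\<alpha> powi ((a + c) * int i), \<beta> powi ((b + d) * int j))"
    using nz by (simp add: g h distrib_right power_int_add)
  ultimately show "(fst g * fst h, snd g * snd h) \<in> subgroup_H \<alpha> \<beta> i j t x"
    unfolding subgroup_H_def by blast
qed

theorem theorem5p1:
  fixes \<alpha> \<beta> :: "'k::{alg_closed_field, field_char_0}"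
    and m n i j t x :: nat
    and \<nu> :: "'k poly poly fract \<Rightarrow> 'g::linordered_ab_group_add"
    and Q :: "nat \<Rightarrow> 'k poly poly"
    and H :: "('k \<times> 'k) set"
    and A :: "'k poly poly set"
  assumes "m > 0" and "n > 0"
    and "primitive_root m \<alpha>" and "primitive_root n \<beta>"
    and "admissible m n i j t x"
    and "gcd (m div i) (n div j) = t"
    and "H = subgroup_H \<alpha> \<beta> i j t x"
    and "A = invariants H"
    and "valuation_on UNIV \<nu>"
    and "rational_rank_one UNIV \<nu>"
    and "\<not> discrete_valuation UNIV \<nu>"
    and "valuation_dominates UNIV \<nu> (localization UNIV maxideal_XY)"
    and "generating_sequence \<nu> Q"
    and "\<forall>l. eigenfunction H (Q l)"
  shows "does_not_split TYPE('h::linordered_ab_group_add)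
           (localization A (maxideal_XY \<inter> A)) (localization UNIV maxideal_XY)
           (restrict \<nu> (quotient_field (emb ` A)))"
proof -
  note roots = \<open>primitive_root m \<alpha>\<close> \<open>primitive_root n \<beta>\<close>
  note H = \<open>H = subgroup_H \<alpha> \<beta> i j t x\<close>
  interpret dominating_valuation \<nu>
    by unfold_locales fact+
  obtain \<rho> :: "'g \<Rightarrow> rat" where
    "generating_valuation \<nu> Q \<rho>"
  proof (rule rational_rank_one_embedding[OF \<open>rational_rank_one UNIV \<nu>\<close> _ val_varX_pos])
    fix \<rho> :: "'g \<Rightarrow> rat"
    assume "\<And>a b. a \<in> vals \<Longrightarrow> b \<in> vals \<Longrightarrow> \<rho> (a + b) = \<rho> a + \<rho> b"
      "\<And>a b. a \<in> vals \<Longrightarrow> b \<in> vals \<Longrightarrow> \<rho> a < \<rho> b \<longleftrightarrow> a < b" "\<rho> (val varX) = 1"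
    then show thesis
      using \<open>generating_sequence \<nu> Q\<close> by (intro that[of \<rho>]) unfold_locales
  qed simp
  then interpret generating_valuation \<nu> Q \<rho> .
  interpret invariant_valuation \<nu> H
  proof
    \<comment> \<open>Here the eigenfunction hypothesis enters: it makes every element of H scale
      each \<open>Q l\<close> and therefore preserve all values.\<close>
    show "val (act g f) = val f" if g: "g \<in> H" and "f \<noteq> 0" for g f
    proof (rule val_act)
      show "fst g \<noteq> 0" "snd g \<noteq> 0"
        using nonzero_subgroup_H[OF roots] g by (auto simp: H)
      show "\<exists>c. act g (Q l) = const2 c * Q l" for l
        using \<open>\<forall>l. eigenfunction H (Q l)\<close> g by (auto simp: eigenfunction_def)
    qed fact
  qed (use subgroup_H_props[OF roots] in \<open>auto simp: H\<close>)
  show ?thesis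
    using does_not_split_invariants
    by (simp add: loc_def UNIV_loc \<open>A = invariants H\<close>)
qed

end
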